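(* Every finite simple graph $G$ satisfies $$\tau(G)\le\frac{165}{59}\,\nu(G).$$
   Context: For a finite simple graph $G$, $\nu(G)$ is the maximum number of pairwise edge-disjoint triangles in $G$, and $\tau(G)$ is the minimum size of a set of edges of $G$ that contains at least one edge of every triangle of $G$. *)

theory Defs
  imports Complex_Main "HOL-Library.Disjoint_Sets"
begin

definition finite_simple_graph :: "'a set \<Rightarrow> 'a set set \<Rightarrow> bool" where
  "finite_simple_graph V E \<longleftrightarrow> finite V \<and> (\<forall>e\<in>E. e \<subseteq> V \<and> card e = 2)"

text \<open>A triangle is represented by its set of three edges, so that edge-disjointness of
  triangles is plain disjointness of sets.\<close>

definition triangles :: "'a set set \<Rightarrow> 'a set set set" where
  "triangles E = {{{x, y}, {y, z}, {x, z}} | x y z.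
     x \<noteq> y \<and> y \<noteq> z \<and> x \<noteq> z \<and> {x, y} \<in> E \<and> {y, z} \<in> E \<and> {x, z} \<in> E}"

definition triangle_packing :: "'a set set \<Rightarrow> 'a set set set \<Rightarrow> bool" where
  "triangle_packing E P \<longleftrightarrow> P \<subseteq> triangles E \<and> disjoint P"

definition triangle_cover :: "'a set set \<Rightarrow> 'a set set \<Rightarrow> bool" where
  "triangle_cover E C \<longleftrightarrow> C \<subseteq> E \<and> (\<forall>T\<in>triangles E. C \<inter> T \<noteq> {})"

definition nu :: "'a set set \<Rightarrow> nat" where
  "nu E = Max {card P | P. triangle_packing E P}"

definition tau :: "'a set set \<Rightarrow> nat" where
  "tau E = Min {card C | C. triangle_cover E C}"

text \<open>\<^const>\<open>Max\<close> and \<^const>\<open>Min\<close> are only meaningful on finite nonempty sets; the following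
  facts show that both extrema are attained.\<close>

lemma finite_edges:
  assumes "finite_simple_graph V E"
  shows "finite E"
proof (rule finite_subset)
  show "E \<subseteq> Pow V" using assms by (auto simp: finite_simple_graph_def)
  show "finite (Pow V)" using assms by (simp add: finite_simple_graph_def)
qed

lemma triangles_subset_Pow: "triangles E \<subseteq> Pow E"
  by (auto simp: triangles_def)

lemma nu_attained:
  assumes "finite E"
  shows "\<exists>P. triangle_packing E P \<and> card P = nu E"
    and "triangle_packing E P \<Longrightarrow> card P \<le> nu E"
proof -
  let ?A = "{card P | P. triangle_packing E P}"
  have "{P. triangle_packing E P} \<subseteq> Pow (Pow E)"
    using triangles_subset_Pow[of E] by (auto simp: triangle_packing_def)
  then have "finite {P. triangle_packing E P}"
    using assms by (meson finite_Pow_iff finite_subset)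
  then have fin: "finite ?A" by simp
  have "triangle_packing E {}" by (simp add: triangle_packing_def disjoint_def)
  then have "?A \<noteq> {}" by blast
  then have "Max ?A \<in> ?A" by (rule Max_in[OF fin])
  then show "\<exists>P. triangle_packing E P \<and> card P = nu E" by (auto simp: nu_def)
  show "card P \<le> nu E" if "triangle_packing E P"
    unfolding nu_def using that by (intro Max_ge[OF fin]) blast
qed

lemma tau_attained:
  assumes "finite E"
  shows "\<exists>C. triangle_cover E C \<and> card C = tau E"
    and "triangle_cover E C \<Longrightarrow> tau E \<le> card C"
proof -
  let ?A = "{card C | C. triangle_cover E C}"
  have "{C. triangle_cover E C} \<subseteq> Pow E" by (auto simp: triangle_cover_def)
  then have "finite {C. triangle_cover E C}"
    using assms by (meson finite_Pow_iff finite_subset)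
  then have fin: "finite ?A" by simp
  have "triangle_cover E E" by (auto simp: triangle_cover_def triangles_def)
  then have "?A \<noteq> {}" by blast
  then have "Min ?A \<in> ?A" by (rule Min_in[OF fin])
  then show "\<exists>C. triangle_cover E C \<and> card C = tau E" by (auto simp: tau_def)
  show "tau E \<le> card C" if "triangle_cover E C"
    unfolding tau_def using that by (intro Min_le[OF fin]) blast
qed

end

theory Submission
  imports Defs
begin

text \<open>
  Let \<open>P\<close> be a maximum packing, \<open>M = \<Union>P\<close>, and sort the triangles by the number of their edges in \<open>M\<close>.
  Among all packings choose one, \<open>S \<union> Q \<union> Z\<close> with members of types 1, 2, 3, that maximises
  \<open>(s, q, z) = (card S, card Q, card Z)\<close> lexicographically. A triangle of type 1 then meets \<open>S\<close>, and one of
  type 2 meets \<open>S \<union> Q\<close>, also after members of \<open>Q\<close> have been exchanged for other triangles of type 2.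
  Such an exchange is provided by a page: a triangle of type 2 that meets \<open>\<Union>(S \<union> Q \<union> Z)\<close> only in the
  edge outside \<open>M\<close> of a member of \<open>Q\<close>. Take a maximal disjoint set of \<open>r\<close> pages; a page and its owner in
  \<open>Q\<close> span four vertices, and \<open>k\<close> counts the pages for which the sixth edge on these vertices has to be
  paid for. Four covers give, with \<open>\<nu> = card P\<close>,

  \<^item> \<open>\<tau> \<le> 3 \<nu> - s\<close>,
  \<^item> \<open>\<tau> \<le> 3 (s + q + z) - 2 r + k\<close>,
  \<^item> \<open>\<tau> \<le> 3 s + 2 q + 3 z + 3 r - k\<close>,
  \<^item> \<open>2 \<tau> \<le> 3 \<nu> + 4 s + 3 q - 2 r + k\<close>, where half of the edges suffice on a suitable subgraph because
    a graph can be made bipartite by deleting at most half of its edges.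

  Adding these with weights 4, 5, 3, 1 and using \<open>s + q + z \<le> \<nu>\<close> and \<open>k \<le> r\<close> yields \<open>14 \<tau> \<le> 39 \<nu>\<close>, and
  \<open>39/14 < 165/59\<close>.
\<close>

section \<open>Triangles with a common edge\<close>

definition edges_on :: "'a set \<Rightarrow> 'a set set" where
  "edges_on X = {e. e \<subseteq> X \<and> card e = 2}"

lemma edges_on_insert3:
  assumes "x \<noteq> y" "y \<noteq> z" "x \<noteq> z"
  shows "edges_on {x, y, z} = {{x, y}, {y, z}, {x, z}}"
proof (intro equalityI subsetI)
  fix e assume "e \<in> edges_on {x, y, z}"
  then obtain p q where "e = {p, q}" "p \<noteq> q" "p \<in> {x, y, z}" "q \<in> {x, y, z}"
    by (auto simp: edges_on_def card_2_iff)
  then show "e \<in> {{x, y}, {y, z}, {x, z}}" by auto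
next
  fix e assume "e \<in> {{x, y}, {y, z}, {x, z}}"
  then show "e \<in> edges_on {x, y, z}" using assms by (auto simp: edges_on_def)
qed

text \<open>Passage from edges to vertices: a triangle is fixed by its vertex set, and it contains
  an edge as soon as it contains both ends.\<close>

lemma triangles_iff:
  "T \<in> triangles E \<longleftrightarrow> card (\<Union>T) = 3 \<and> T = edges_on (\<Union>T) \<and> T \<subseteq> E"
proof
  assume "T \<in> triangles E"
  then obtain x y z where T: "T = {{x, y}, {y, z}, {x, z}}" "x \<noteq> y" "y \<noteq> z" "x \<noteq> z"
    "{x, y} \<in> E" "{y, z} \<in> E" "{x, z} \<in> E" by (auto simp: triangles_def)
  then have "\<Union>T = {x, y, z}" by auto
  then show "card (\<Union>T) = 3 \<and> T = edges_on (\<Union>T) \<and> T \<subseteq> E"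
    using T edges_on_insert3[of x y z] by auto
next
  assume T: "card (\<Union>T) = 3 \<and> T = edges_on (\<Union>T) \<and> T \<subseteq> E"
  then obtain x y z where xyz: "\<Union>T = {x, y, z}" "x \<noteq> y" "y \<noteq> z" "x \<noteq> z"
    by (auto simp: card_3_iff)
  then have "T = {{x, y}, {y, z}, {x, z}}" using T edges_on_insert3[of x y z] by auto
  moreover from this have "{x, y} \<in> E" "{y, z} \<in> E" "{x, z} \<in> E" using T by blast+
  ultimately show "T \<in> triangles E" using xyz(2-4) unfolding triangles_def by blast
qed

lemma triangle_vertices:
  assumes "T \<in> triangles E" shows "card (\<Union>T) = 3" "T \<subseteq> E" "finite (\<Union>T)"
proof -
  show *: "card (\<Union>T) = 3" and "T \<subseteq> E" using assms by (simp_all only: triangles_iff)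
  show "finite (\<Union>T)" using * by (metis card.infinite zero_neq_numeral)
qed

lemma triangle_card:
  assumes "T \<in> triangles E" shows "card T = 3" "finite T" "T \<noteq> {}"
proof -
  obtain x y z where T: "T = {{x, y}, {y, z}, {x, z}}" "x \<noteq> y" "y \<noteq> z" "x \<noteq> z"
    using assms by (auto simp: triangles_def)
  then have "{x,y} \<noteq> {y,z}" "{x,y} \<noteq> {x,z}" "{y,z} \<noteq> {x,z}" by (auto simp: doubleton_eq_iff)
  then show "card T = 3" using T by simp
  then show "finite T" "T \<noteq> {}" using card.infinite by fastforce+
qed

lemma triangle_mem:
  assumes "T \<in> triangles E"
  shows "e \<in> T \<longleftrightarrow> e \<subseteq> \<Union>T \<and> card e = 2"
  using assms unfolding triangles_iff edges_on_def by blast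

lemma triangle_edges_meet:
  assumes T: "T \<in> triangles E" and "e \<in> T" "f \<in> T" shows "e \<inter> f \<noteq> {}"
proof
  assume "e \<inter> f = {}"
  have fin: "finite (\<Union>T)" by (rule triangle_vertices[OF T])
  have ef: "e \<subseteq> \<Union>T" "f \<subseteq> \<Union>T" "card e = 2" "card f = 2" using assms triangle_mem[OF T] by auto
  have "card (e \<union> f) = 4" using ef \<open>e \<inter> f = {}\<close> fin by (simp add: card_Un_disjoint finite_subset)
  moreover have "card (e \<union> f) \<le> card (\<Union>T)" using ef fin by (intro card_mono) auto
  ultimately show False using triangle_vertices(1)[OF T] by simp
qed

lemma triangle_apex:
  assumes T: "T \<in> triangles E" and e: "e \<in> T"
  obtains v where "\<Union>T = insert v e" "v \<notin> e" "card e = 2" "finite e"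
proof -
  have c: "card e = 2" "e \<subseteq> \<Union>T" "card (\<Union>T) = 3"
    using e triangle_mem[OF T, of e] triangle_vertices[OF T] by simp_all
  then have "finite e" "finite (\<Union>T)" by (metis card.infinite zero_neq_numeral)+
  then have "card (\<Union>T - e) = 1" using c by (simp add: card_Diff_subset)
  then obtain v where "\<Union>T - e = {v}" by (auto simp: card_1_singleton_iff)
  then show ?thesis using that[of v] c \<open>finite e\<close> by blast
qed

lemma triangle_eqI:
  assumes "S \<in> triangles E" "T \<in> triangles E" "\<Union>S = \<Union>T" shows "S = T"
  using assms by (metis triangles_iff)

text \<open>For two triangles with a common edge, the edge that completes them to a $K_4$.\<close>

definition opp :: "'a set set \<Rightarrow> 'a set set \<Rightarrow> 'a set" where
  "opp D T = (\<Union>D \<union> \<Union>T) - (\<Union>D \<inter> \<Union>T)"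

lemma opp_eq:
  assumes D: "D \<in> triangles E" and T: "T \<in> triangles E" and DT: "D \<inter> T = {n}"
  obtains v w where "\<Union>D = insert v n" "\<Union>T = insert w n" "v \<notin> n" "w \<notin> n" "v \<noteq> w"
    "card n = 2" "opp D T = {v, w}"
proof -
  have n: "n \<in> D" "n \<in> T" using DT by auto
  obtain v where v: "\<Union>D = insert v n" "v \<notin> n" "card n = 2" by (rule triangle_apex[OF D n(1)])
  obtain w where w: "\<Union>T = insert w n" "w \<notin> n" by (rule triangle_apex[OF T n(2)])
  have "v \<noteq> w"
  proof
    assume "v = w"
    then have "D = T" using v w triangle_eqI[OF D T] by simp
    then have "D = {n}" using DT by simp
    then show False using triangle_card(1)[OF D] by simp
  qed
  then show ?thesis using v w that[of v w] by (auto simp: opp_def)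
qed

text \<open>\<open>opp D T\<close> joins the two apexes and so is disjoint from \<open>n\<close>,
  whereas two edges of one triangle always meet.\<close>

lemma opp_notin:
  assumes D: "D \<in> triangles E" and T: "T \<in> triangles E" and DT: "D \<inter> T = {n}"
    and U: "U \<in> triangles E" "n \<in> U"
  shows "opp D T \<notin> U"
proof
  assume *: "opp D T \<in> U"
  obtain v w where "v \<notin> n" "w \<notin> n" "opp D T = {v, w}" by (rule opp_eq[OF D T DT])
  then show False using triangle_edges_meet[OF U(1) * U(2)] by auto
qed

text \<open>An edge of \<open>D\<close> other than \<open>n\<close> contains the apex of
  \<open>D\<close>, and likewise for \<open>T\<close>; so \<open>U\<close> has both apexes as
  vertices. Consequently a triangle that avoids \<open>n\<close> and \<open>opp D T\<close> misses
  \<open>D\<close> or \<open>T\<close>.\<close>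

lemma opp_in:
  assumes D: "D \<in> triangles E" and T: "T \<in> triangles E" and DT: "D \<inter> T = {n}"
    and U: "U \<in> triangles E" and m: "m \<in> U \<inter> D" "m \<noteq> n" and f: "f \<in> U \<inter> T" "f \<noteq> n"
  shows "opp D T \<in> U"
proof -
  obtain v w where vw: "\<Union>D = insert v n" "\<Union>T = insert w n" "v \<notin> n" "w \<notin> n" "v \<noteq> w"
    "card n = 2" "opp D T = {v, w}" by (rule opp_eq[OF D T DT])
  have fin: "finite n" using vw(6) by (metis card.infinite zero_neq_numeral)
  have m': "m \<subseteq> insert v n" "card m = 2" using m triangle_mem[OF D, of m] vw(1) by auto
  have f': "f \<subseteq> insert w n" "card f = 2" using f triangle_mem[OF T, of f] vw(2) by auto
  have "v \<in> m" using m' m(2) vw(6) fin by (metis card_subset_eq subset_insert)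
  moreover have "w \<in> f" using f' f(2) vw(6) fin by (metis card_subset_eq subset_insert)
  moreover have "m \<subseteq> \<Union>U" "f \<subseteq> \<Union>U" using m f by auto
  ultimately have "{v, w} \<subseteq> \<Union>U" by auto
  then show ?thesis using triangle_mem[OF U] vw by simp
qed

text \<open>Either end \<open>x\<close> of \<open>n\<close> spans a triangle with the two
  apexes.\<close>

lemma opp_triangle:
  assumes D: "D \<in> triangles E" and T: "T \<in> triangles E" and DT: "D \<inter> T = {n}"
    and E: "opp D T \<in> E"
  obtains m f where "m \<in> D" "m \<noteq> n" "f \<in> T" "f \<noteq> n" "{m, f, opp D T} \<in> triangles E"
    "opp D T \<notin> D" "opp D T \<notin> T"
proof -
  obtain v w where vw: "\<Union>D = insert v n" "\<Union>T = insert w n" "v \<notin> n" "w \<notin> n" "v \<noteq> w"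
    "card n = 2" "opp D T = {v, w}" by (rule opp_eq[OF D T DT])
  obtain x where x: "x \<in> n" using vw(6) by fastforce
  have xv: "x \<noteq> v" "x \<noteq> w" using x vw by auto
  have m: "{x, v} \<in> D" using triangle_mem[OF D, of "{x, v}"] vw x xv by auto
  have f: "{x, w} \<in> T" using triangle_mem[OF T, of "{x, w}"] vw x xv by auto
  have "{{x, v}, {v, w}, {x, w}} \<in> triangles E"
  proof -
    have "{x, v} \<in> E" "{v, w} \<in> E" "{x, w} \<in> E"
      using m f E vw triangle_vertices(2)[OF D] triangle_vertices(2)[OF T] by auto
    then show ?thesis unfolding triangles_def using xv vw(5) by blast
  qed
  moreover have "{{x, v}, {v, w}, {x, w}} = {{x, v}, {x, w}, opp D T}" using vw by auto
  moreover have "{x, v} \<noteq> n" "{x, w} \<noteq> n" using vw by auto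
  moreover have "opp D T \<notin> D" "opp D T \<notin> T"
    using opp_notin[OF D T DT D] opp_notin[OF D T DT T] DT by blast+
  ultimately show ?thesis using m f that[of "{x, v}" "{x, w}"] by metis
qed

text \<open>Beyond the vertices of \<open>S\<close>, each of \<open>T\<close> and \<open>U\<close>
  has one vertex only. If these differed, a common edge would lie within the vertices of
  \<open>S\<close> and equal both \<open>b\<close> and \<open>c\<close>. Hence \<open>T\<close> is
  determined by \<open>b\<close> and \<open>U\<close>.\<close>

lemma page_unique:
  assumes S: "S \<in> triangles E" and b: "b \<noteq> c"
    and T: "T \<in> triangles E" "T \<inter> S = {b}" and U: "U \<in> triangles E" "U \<inter> S = {c}"
    and meet: "T \<inter> U \<noteq> {}"
  shows "\<Union>T = b \<union> (\<Union>U - \<Union>S)"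
proof -
  obtain p z where pz: "\<Union>S = insert p b" "\<Union>T = insert z b" "p \<notin> b" "z \<notin> b" "p \<noteq> z" "card b = 2"
    using opp_eq[OF S T(1), of b] T(2) by (metis Int_commute)
  obtain p' z' where pz': "\<Union>S = insert p' c" "\<Union>U = insert z' c" "p' \<notin> c" "z' \<notin> c" "p' \<noteq> z'" "card c = 2"
    using opp_eq[OF S U(1), of c] U(2) by (metis Int_commute)
  obtain h where h: "h \<in> T" "h \<in> U" using meet by auto
  have h2: "h \<subseteq> insert z b" "h \<subseteq> insert z' c" "card h = 2"
    using h triangle_mem[OF T(1), of h] triangle_mem[OF U(1), of h] pz(2) pz'(2) by simp_all
  have zS: "z \<notin> \<Union>S" "z' \<notin> \<Union>S" using pz pz' by auto
  have fin: "finite b" "finite c" using pz(6) pz'(6) by (metis card.infinite zero_neq_numeral)+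
  have "z = z'"
  proof (rule ccontr)
    assume "z \<noteq> z'"
    then have "h \<subseteq> b" "h \<subseteq> c" using h2 zS pz(1) pz'(1) by auto
    then have "h = b" "h = c" using fin h2(3) pz(6) pz'(6) by (metis card_subset_eq)+
    then show False using b by simp
  qed
  moreover have "\<Union>U - \<Union>S = {z'}" using pz'(1,2) zS by auto
  ultimately show ?thesis using pz(2) by auto
qed

section \<open>Halving the edges by a bipartition\<close>

lemma bipartite_half:
  assumes "finite V"
  shows "finite H \<Longrightarrow> \<forall>e\<in>H. e \<subseteq> V \<and> card e = 2 \<Longrightarrow>
    \<exists>U\<subseteq>V. 2 * card {e \<in> H. e \<subseteq> U \<or> e \<inter> U = {}} \<le> card H"
  using assms
proof (induction V arbitrary: H rule: finite_induct)
  case empty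
  then have "H = {}" by fastforce
  then show ?case by auto
next
  case (insert v V)
  define H0 where "H0 = {e \<in> H. v \<notin> e}"
  define H1 where "H1 = {e \<in> H. v \<in> e}"
  have fin: "finite H0" "finite H1" using insert.prems by (auto simp: H0_def H1_def)
  have H: "H = H0 \<union> H1" "H0 \<inter> H1 = {}" by (auto simp: H0_def H1_def)
  have "\<forall>e\<in>H0. e \<subseteq> V \<and> card e = 2" using insert.prems by (auto simp: H0_def)
  from insert.IH[OF fin(1) this] obtain U where
    U: "U \<subseteq> V" "2 * card {e \<in> H0. e \<subseteq> U \<or> e \<inter> U = {}} \<le> card H0" by blast
  \<comment> \<open>The edges in \<open>I\<close> stay uncut if \<open>v\<close> remains outside
    \<open>U\<close>, the other edges at \<open>v\<close> if \<open>v\<close> joins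
    \<open>U\<close>. The smaller group decides the side.\<close>
  define I where "I = {e \<in> H1. e \<inter> U = {}}"
  have vU: "v \<notin> U" using U(1) insert.hyps by auto
  have nb: "e \<subseteq> insert v U \<longleftrightarrow> e \<inter> U \<noteq> {}" if "e \<in> H1" for e
  proof -
    have "card e = 2" "v \<in> e" using that insert.prems by (auto simp: H1_def)
    then obtain u where "e = {v, u}" "u \<noteq> v" by (auto simp: card_2_iff)
    then show ?thesis using vU by auto
  qed
  have I: "I \<subseteq> H1" "finite I" using fin by (auto simp: I_def)
  have c1: "card H1 = card I + card (H1 - I)"
    using card_Diff_subset[OF I(2,1)] card_mono[OF fin(2) I(1)] by simp
  have cH: "card H = card H0 + card H1" using H fin by (simp add: card_Un_disjoint)
  have e0: "{e \<in> H0. e \<subseteq> insert v U \<or> e \<inter> insert v U = {}} = {e \<in> H0. e \<subseteq> U \<or> e \<inter> U = {}}"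
    using vU by (auto simp: H0_def)
  show ?case
  proof (cases "2 * card I \<le> card H1")
    case True
    have "{e \<in> H. e \<subseteq> U \<or> e \<inter> U = {}} = {e \<in> H0. e \<subseteq> U \<or> e \<inter> U = {}} \<union> I"
      using H vU by (auto simp: I_def H1_def)
    then have "card {e \<in> H. e \<subseteq> U \<or> e \<inter> U = {}} \<le> card {e \<in> H0. e \<subseteq> U \<or> e \<inter> U = {}} + card I"
      by (simp add: card_Un_le)
    then show ?thesis using True U cH by (intro exI[of _ U]) auto
  next
    case False
    have "{e \<in> H. e \<subseteq> insert v U \<or> e \<inter> insert v U = {}}
        = {e \<in> H0. e \<subseteq> insert v U \<or> e \<inter> insert v U = {}} \<union> (H1 - I)"
      using H nb by (auto simp: I_def H1_def)
    then have "card {e \<in> H. e \<subseteq> insert v U \<or> e \<inter> insert v U = {}}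
        \<le> card {e \<in> H0. e \<subseteq> U \<or> e \<inter> U = {}} + card (H1 - I)"
      unfolding e0 by (simp add: card_Un_le)
    then show ?thesis using False U cH c1 by (intro exI[of _ "insert v U"]) auto
  qed
qed

text \<open>Two of the three vertices of a triangle fall on the same side, so the uncut edges form a
  cover.\<close>

lemma half_cover:
  assumes "finite V" "finite H" "\<forall>e\<in>H. e \<subseteq> V \<and> card e = 2"
  obtains C where "C \<subseteq> H" "2 * card C \<le> card H" 
    "\<And>T. T \<in> triangles E \<Longrightarrow> T \<subseteq> H \<Longrightarrow> T \<inter> C \<noteq> {}"
proof -
  obtain U where U: "2 * card {e \<in> H. e \<subseteq> U \<or> e \<inter> U = {}} \<le> card H"
    using bipartite_half[OF assms] by blast
  have "T \<inter> {e \<in> H. e \<subseteq> U \<or> e \<inter> U = {}} \<noteq> {}" if T: "T \<in> triangles E" "T \<subseteq> H" for T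
  proof -
    obtain x y z where xyz: "T = {{x, y}, {y, z}, {x, z}}" using T by (auto simp: triangles_def)
    have "{x,y} \<subseteq> U \<or> {x,y} \<inter> U = {} \<or> {y,z} \<subseteq> U \<or> {y,z} \<inter> U = {} \<or> {x,z} \<subseteq> U \<or> {x,z} \<inter> U = {}"
      by blast
    then show ?thesis using T(2) xyz by blast
  qed
  then show ?thesis using that[of "{e \<in> H. e \<subseteq> U \<or> e \<inter> U = {}}"] U by blast
qed

section \<open>Exchanging members of a disjoint family\<close>

lemma swap_disjoint:
  assumes "disjoint X" "disjoint J"
    and own: "\<And>T. T \<in> J \<Longrightarrow> own T \<in> X \<and> T \<inter> \<Union>X \<subseteq> own T"
  shows "disjoint (X - own ` J \<union> J)"
proof (rule disjointI)
  fix A B assume AB: "A \<in> X - own ` J \<union> J" "B \<in> X - own ` J \<union> J" "A \<noteq> B"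
  \<comment> \<open>\<open>T\<close> meets \<open>\<Union>X\<close> only inside its owner, which has
    been removed. Several members of \<open>J\<close> may share an owner, so one triangle can be
    traded for two.\<close>
  have key: "A \<inter> T = {}" if "A \<in> X - own ` J" "T \<in> J" for A T
  proof -
    have "A \<noteq> own T" "A \<in> X" using that by auto
    then have "A \<inter> own T = {}" using disjointD[OF assms(1)] own[OF that(2)] by blast
    then show ?thesis using own[OF that(2)] \<open>A \<in> X\<close> by blast
  qed
  show "A \<inter> B = {}"
    using AB key[of A B] key[of B A] disjointD[OF assms(1), of A B] disjointD[OF assms(2), of A B] by blast
qed

lemma swap_card:
  assumes "finite X" "finite J" "inj_on own J" 
    and own: "\<And>T. T \<in> J \<Longrightarrow> own T \<in> X \<and> T \<notin> X"
  shows "card (X - own ` J \<union> J) = card X"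
proof -
  have "own ` J \<subseteq> X" using own by auto
  then have "card (X - own ` J) = card X - card J" "card J \<le> card X"
    using assms card_image[OF assms(3)] card_mono[of X "own ` J"] by (auto simp: card_Diff_subset)
  moreover have "(X - own ` J) \<inter> J = {}" using own by auto
  ultimately show ?thesis using assms by (simp add: card_Un_disjoint)
qed

text \<open>If \<open>U\<close> misses the replacement or the owner in every pair, exchanging
  exactly the owners that \<open>U\<close> hits leaves room for \<open>U\<close>. The covers below
  are built to force this, against a maximality property.\<close>

lemma swap_avoids:
  assumes "U \<inter> \<Union>(X - own ` R) = {}" and "\<And>T. T \<in> R \<Longrightarrow> U \<inter> own T = {} \<or> U \<inter> T = {}"
  shows "U \<inter> \<Union>(X - own ` {T \<in> R. U \<inter> own T \<noteq> {}} \<union> {T \<in> R. U \<inter> own T \<noteq> {}}) = {}"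
  using assms by blast

section \<open>Packings\<close>

lemma packing_finite:
  assumes "finite E" "X \<subseteq> triangles E" shows "finite X"
  using assms triangles_subset_Pow[of E] by (meson finite_Pow_iff finite_subset)

lemma packing_insert:
  assumes X: "triangle_packing E X" and U: "U \<in> triangles E" "U \<inter> \<Union>X = {}"
  shows "triangle_packing E (insert U X)" "U \<notin> X"
proof -
  show "U \<notin> X" using U triangle_card(3)[OF U(1)] by blast
  have "disjoint (insert U X)"
    using X U by (auto simp: triangle_packing_def pairwise_insert disjnt_def)
  then show "triangle_packing E (insert U X)" using X U by (simp add: triangle_packing_def)
qed

lemma card_Union_triangles:
  assumes "finite X" "X \<subseteq> triangles E" shows "card (\<Union>X) \<le> 3 * card X"
proof -
  have "card (\<Union>X) \<le> (\<Sum>T\<in>X. card T)" by (rule card_Union_le_sum_card)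
  also have "\<dots> = (\<Sum>T\<in>X. 3)" using assms triangle_card(1) by (intro sum.cong) auto
  finally show ?thesis by simp
qed

lemma card_Union_Int:
  assumes "finite X" "\<And>T. T \<in> X \<Longrightarrow> card (T \<inter> M) = k" shows "card (\<Union>X \<inter> M) \<le> k * card X"
proof -
  have "\<Union>X \<inter> M = (\<Union>T\<in>X. T \<inter> M)" by auto
  then have "card (\<Union>X \<inter> M) \<le> (\<Sum>T\<in>X. card (T \<inter> M))" using card_UN_le[OF assms(1)] by metis
  also have "\<dots> = (\<Sum>T\<in>X. k)" using assms by (intro sum.cong) auto
  finally show ?thesis by (simp add: mult.commute)
qed

text \<open>In \<open>cover_half_bound\<close> such edges are removed from the edge set of the
  maximum packing, so their number is needed from below as well as from above.\<close>

lemma card_Union_Int_disjoint: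
  assumes "finite X" "disjoint X" "\<And>T. T \<in> X \<Longrightarrow> finite T \<and> card (T \<inter> M) = k"
  shows "card (\<Union>X \<inter> M) = k * card X"
proof -
  have "\<Union>X \<inter> M = (\<Union>T\<in>X. T \<inter> M)" by auto
  also have "card \<dots> = (\<Sum>T\<in>X. card (T \<inter> M))"
    using assms by (intro card_UN_disjoint) (auto simp: disjoint_def)
  also have "\<dots> = (\<Sum>T\<in>X. k)" using assms by (intro sum.cong) auto
  finally show ?thesis by (simp add: mult.commute)
qed

lemma card_Diff_triangle:
  assumes "T \<in> triangles E" "card (T \<inter> M) = k" shows "card (T \<inter> - M) = 3 - k" "k \<le> 3"
proof -
  have f: "finite T" and c: "card T = 3" using triangle_card[OF assms(1)] by auto
  have "T = (T \<inter> M) \<union> (T \<inter> - M)" by auto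
  then have "card T = card (T \<inter> M) + card (T \<inter> - M)"
    using f by (metis card_Un_disjoint finite_Int Int_assoc Int_commute Compl_disjoint Int_empty_right Int_left_commute)
  then show "card (T \<inter> - M) = 3 - k" "k \<le> 3" using c assms(2) by auto
qed

text \<open>A member of \<open>S\<close> together with the member of \<open>P\<close> that it meets costs only two edges, the common
  one and \<open>opp\<close>: a triangle that avoids both misses one of the two members, which is then used in
  the packing.\<close>

lemma tau_singles_bound:
  assumes finE: "finite E" and P: "triangle_packing E P"
    and maxP: "\<And>P'. triangle_packing E P' \<Longrightarrow> card P' \<le> card P"
    and S: "S \<subseteq> triangles E" "disjoint S" and S1: "\<And>T. T \<in> S \<Longrightarrow> card (T \<inter> \<Union>P) = 1"
  shows "tau E + card S \<le> 3 * card P"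
proof -
  have Ptri: "P \<subseteq> triangles E" "disjoint P" using P by (auto simp: triangle_packing_def)
  have finP: "finite P" and finS: "finite S" using packing_finite[OF finE] Ptri S by auto
  have SP: "T \<notin> P" if "T \<in> S" for T
  proof
    assume "T \<in> P"
    then have "T \<inter> \<Union>P = T" by auto
    then show False using S1[OF that] triangle_card(1)[of T E] S that by auto
  qed
  have "\<exists>D n. D \<in> P \<and> T \<inter> \<Union>P = {n} \<and> D \<inter> T = {n}" if T: "T \<in> S" for T
  proof -
    obtain n where n: "T \<inter> \<Union>P = {n}" using S1[OF T] by (auto simp: card_1_singleton_iff)
    then obtain D where "D \<in> P" "n \<in> D" by auto
    then show ?thesis using n by blast
  qed
  then obtain own sp where own: "\<And>T. T \<in> S \<Longrightarrow> own T \<in> P \<and> T \<inter> \<Union>P = {sp T} \<and> own T \<inter> T = {sp T}"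
    by metis
  have swap: "triangle_packing E (P - own ` J \<union> J)" if "J \<subseteq> S" for J
  proof -
    have "own T \<in> P \<and> T \<inter> \<Union>P \<subseteq> own T" if T: "T \<in> J" for T
    proof -
      have o: "own T \<in> P" "T \<inter> \<Union>P = {sp T}" "own T \<inter> T = {sp T}"
        using own[of T] T \<open>J \<subseteq> S\<close> by auto
      from o(3) have "sp T \<in> own T" by blast
      then show ?thesis using o(1) unfolding o(2) by simp
    qed
    from swap_disjoint[OF Ptri(2) pairwise_subset[OF S(2) \<open>J \<subseteq> S\<close>] this]
    have "disjoint (P - own ` J \<union> J)" .
    then show ?thesis using Ptri S that by (auto simp: triangle_packing_def)
  qed
  \<comment> \<open>Two members of \<open>S\<close> with one owner could both replace it, which
    would enlarge \<open>P\<close>.\<close>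
  have inj: "inj_on own S"
  proof (rule inj_onI, rule ccontr)
    fix T U assume TU: "T \<in> S" "U \<in> S" "own T = own U" "T \<noteq> U"
    have "P - own ` {T, U} \<union> {T, U} = insert T (insert U (P - {own T}))" using TU by auto
    moreover have "card (insert T (insert U (P - {own T}))) = card P - 1 + 2"
      using TU SP own finP by (simp add: card_Diff_singleton)
    moreover have "card P > 0" using own[OF TU(1)] finP by (auto simp: card_gt_0_iff)
    ultimately show False using maxP[OF swap[of "{T, U}"]] TU by auto
  qed
  \<comment> \<open>All edges of the unpaired members of \<open>P\<close>, and for each pair the
    common edge and \<open>opp\<close>, which need not be an edge of the graph.\<close>
  define C where "C = \<Union>(P - own ` S) \<union> sp ` S \<union> ((\<lambda>T. opp (own T) T) ` S \<inter> E)"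
  have CE: "C \<subseteq> E"
  proof -
    have "\<Union>P \<subseteq> E" using Ptri triangles_subset_Pow[of E] by auto
    moreover have "sp T \<in> \<Union>P" if "T \<in> S" for T using own[OF that] by blast
    ultimately show ?thesis by (auto simp: C_def)
  qed
  have "triangle_cover E C"
    unfolding triangle_cover_def
  proof (intro conjI CE ballI notI)
    fix U assume U: "U \<in> triangles E" and CU: "C \<inter> U = {}"
    define J where "J = {T \<in> S. U \<inter> own T \<noteq> {}}"
    have "U \<inter> own T = {} \<or> U \<inter> T = {}" if T: "T \<in> S" for T
    proof (rule ccontr)
      assume "\<not> ?thesis"
      then obtain m f where mf: "m \<in> U \<inter> own T" "f \<in> U \<inter> T" by auto
      have "sp T \<notin> U" using CU T by (auto simp: C_def)
      then have ne: "m \<noteq> sp T" "f \<noteq> sp T" using mf by auto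
      have "opp (own T) T \<in> U"
        by (rule opp_in[OF _ _ _ U mf(1) ne(1) mf(2) ne(2)]) (use own[OF T] Ptri S T in auto)
      then show False using CU T triangle_vertices(2)[OF U] unfolding C_def by blast
    qed
    then have "U \<inter> \<Union>(P - own ` J \<union> J) = {}"
      unfolding J_def using CU by (intro swap_avoids) (auto simp: C_def)
    then have ins: "triangle_packing E (insert U (P - own ` J \<union> J))" "U \<notin> P - own ` J \<union> J"
      using packing_insert[OF swap U] by (auto simp: J_def)
    have "card (P - own ` J \<union> J) = card P"
      using own SP inj finP finS by (intro swap_card) (auto simp: J_def intro: inj_on_subset)
    moreover have "finite (P - own ` J \<union> J)" using finP finS by (auto simp: J_def)
    ultimately show False using maxP[OF ins(1)] ins(2) by simp
  qed
  then have "tau E \<le> card C" by (rule tau_attained(2)[OF finE])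
  also have "card C \<le> card (\<Union>(P - own ` S)) + card (sp ` S) + card ((\<lambda>T. opp (own T) T) ` S \<inter> E)"
    unfolding C_def by (meson add_le_mono1 card_Un_le le_trans)
  also have "\<dots> \<le> 3 * card (P - own ` S) + card S + card S"
    using card_Union_triangles[of "P - own ` S" E] finP Ptri finS card_image_le[OF finS, of sp]
      card_image_le[OF finS, of "\<lambda>T. opp (own T) T"]
      card_mono[of "(\<lambda>T. opp (own T) T) ` S" "(\<lambda>T. opp (own T) T) ` S \<inter> E"]
    by (fastforce intro!: add_mono)
  also have "card (P - own ` S) = card P - card S"
    using own inj finP by (subst card_Diff_subset) (auto simp: card_image intro: finite_subset)
  finally have "tau E \<le> 3 * (card P - card S) + card S + card S" .
  moreover have "card S \<le> card P"
    using card_inj_on_le[OF inj, of P] own finP by auto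
  ultimately show ?thesis by simp
qed

section \<open>The lexicographically maximal packing, sorted by type\<close>

locale lex_packing =
  fixes V :: "'a set" and E :: "'a set set" and P S Q Z :: "'a set set set"
  assumes graph: "finite_simple_graph V E"
    and packP: "triangle_packing E P"
    and maxP: "triangle_packing E P' \<Longrightarrow> card P' \<le> card P"
    and pack: "triangle_packing E (S \<union> Q \<union> Z)"
    and S1: "T \<in> S \<Longrightarrow> card (T \<inter> \<Union>P) = 1"
    and Q2: "T \<in> Q \<Longrightarrow> card (T \<inter> \<Union>P) = 2"
    and Z3: "T \<in> Z \<Longrightarrow> card (T \<inter> \<Union>P) = 3"
    and maxS: "triangle_packing E S' \<Longrightarrow> (\<And>T. T \<in> S' \<Longrightarrow> card (T \<inter> \<Union>P) = 1) \<Longrightarrow> card S' \<le> card S"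
    and maxQ: "triangle_packing E (S \<union> Q') \<Longrightarrow> (\<And>T. T \<in> Q' \<Longrightarrow> card (T \<inter> \<Union>P) = 2) \<Longrightarrow>
      card Q' \<le> card Q"
    and maxZ: "triangle_packing E (S \<union> Q' \<union> Z') \<Longrightarrow> (\<And>T. T \<in> Q' \<Longrightarrow> card (T \<inter> \<Union>P) = 2) \<Longrightarrow>
      (\<And>T. T \<in> Z' \<Longrightarrow> card (T \<inter> \<Union>P) = 3) \<Longrightarrow> card Q' = card Q \<Longrightarrow> card Z' \<le> card Z"
begin

abbreviation M :: "'a set set" where "M \<equiv> \<Union>P"

lemma finE: "finite E" using graph by (rule finite_edges)

lemma tri: "P \<subseteq> triangles E" "S \<subseteq> triangles E" "Q \<subseteq> triangles E" "Z \<subseteq> triangles E"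
  and disj: "disjoint P" "disjoint S" "disjoint Q" "disjoint Z" "disjoint (S \<union> Q \<union> Z)"
  using packP pack by (auto simp: triangle_packing_def intro: pairwise_subset)

lemma fin: "finite P" "finite S" "finite Q" "finite Z"
  using packing_finite[OF finE] tri by auto

lemma triE: "T \<in> triangles E \<Longrightarrow> T \<subseteq> E"
  by (rule triangle_vertices(2))

lemma ME: "M \<subseteq> E" using tri triE by blast

lemma Z_M: "\<Union>Z \<subseteq> M"
proof -
  have "T \<subseteq> M" if "T \<in> Z" for T
  proof -
    have "T \<in> triangles E" using tri that by auto
    then have "T \<inter> M = T" using Z3[OF that] triangle_card(1,2)[of T E]
      by (intro card_subset_eq) auto
    then show ?thesis by auto
  qed
  then show ?thesis by auto
qed

lemma distinct_types: "S \<inter> Q = {}" "S \<inter> Z = {}" "Q \<inter> Z = {}"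
  using S1 Q2 Z3 by fastforce+

lemma cross: "A \<in> S \<union> Q \<union> Z \<Longrightarrow> B \<in> S \<union> Q \<union> Z \<Longrightarrow> A \<noteq> B \<Longrightarrow> A \<inter> B = {}"
  using disj(5) by (rule disjointD)

lemma SQ_disj: "\<Union>S \<inter> \<Union>Q = {}" "\<Union>S \<inter> \<Union>Z = {}" "\<Union>Q \<inter> \<Union>Z = {}"
  using cross distinct_types by blast+

section \<open>Triangles that must meet the chosen packing\<close>

lemma hit0:
  assumes U: "U \<in> triangles E" shows "U \<inter> M \<noteq> {}"
proof
  assume "U \<inter> M = {}"
  from packing_insert[OF packP U this] maxP[of "insert U P"] show False using fin by simp
qed

lemma hit1:
  assumes U: "U \<in> triangles E" "card (U \<inter> M) = 1" shows "U \<inter> \<Union>S \<noteq> {}"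
proof
  assume *: "U \<inter> \<Union>S = {}"
  have "triangle_packing E S" using tri disj by (simp add: triangle_packing_def)
  from packing_insert[OF this U(1) *] have "triangle_packing E (insert U S)" "U \<notin> S" .
  then show False using maxS[of "insert U S"] S1 U(2) fin by auto
qed

text \<open>Allowing any \<open>Q'\<close> of the size of \<open>Q\<close> makes this usable after
  pages have replaced their owners.\<close>

lemma hit2:
  assumes U: "U \<in> triangles E" "card (U \<inter> M) = 2"
    and Q': "triangle_packing E (S \<union> Q')" "\<And>T. T \<in> Q' \<Longrightarrow> card (T \<inter> M) = 2" "card Q' = card Q"
  shows "U \<inter> \<Union>(S \<union> Q') \<noteq> {}"
proof
  assume *: "U \<inter> \<Union>(S \<union> Q') = {}"
  from packing_insert[OF Q'(1) U(1) *] have 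
    "triangle_packing E (S \<union> insert U Q')" "U \<notin> Q'" by auto
  moreover have "finite Q'" using packing_finite[OF finE, of Q'] Q'(1) by (auto simp: triangle_packing_def)
  ultimately show False using maxQ[of "insert U Q'"] Q' U(2) by auto
qed

text \<open>Adding \<open>U\<close> to \<open>Z\<close> beats \<open>Z\<close> even with
  \<open>Q'\<close> in place of \<open>Q\<close>, since \<open>maxZ\<close> fixes only the size of
  the part of type 2.\<close>

lemma hit3:
  assumes U: "U \<in> triangles E" "card (U \<inter> M) = 3"
    and Q': "triangle_packing E (S \<union> Q' \<union> Z)" "\<And>T. T \<in> Q' \<Longrightarrow> card (T \<inter> M) = 2" "card Q' = card Q"
  shows "U \<inter> \<Union>(S \<union> Q' \<union> Z) \<noteq> {}"
proof
  assume *: "U \<inter> \<Union>(S \<union> Q' \<union> Z) = {}"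
  from packing_insert[OF Q'(1) U(1) *] have 
    "triangle_packing E (S \<union> Q' \<union> insert U Z)" "U \<notin> Z" by auto
  then show False using maxZ[of Q' "insert U Z"] Q' Z3 U(2) fin by auto
qed

lemma type_cases:
  assumes "U \<in> triangles E"
  obtains "card (U \<inter> M) = 1" | "card (U \<inter> M) = 2" | "card (U \<inter> M) = 3"
proof -
  have "card (U \<inter> M) \<noteq> 0" using hit0[OF assms] triangle_card(2)[OF assms] by auto
  moreover have "card (U \<inter> M) \<le> 3" using card_Diff_triangle(2)[OF assms refl] .
  ultimately show ?thesis using that by linarith
qed

lemma hit_all:
  assumes U: "U \<in> triangles E"
    and Q': "triangle_packing E (S \<union> Q' \<union> Z)" "\<And>T. T \<in> Q' \<Longrightarrow> card (T \<inter> M) = 2" "card Q' = card Q"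
  shows "U \<inter> \<Union>(S \<union> Q' \<union> Z) \<noteq> {}"
proof (rule type_cases[OF U])
  assume "card (U \<inter> M) = 1"
  then show ?thesis using hit1[OF U] by auto
next
  assume c: "card (U \<inter> M) = 2"
  have "triangle_packing E (S \<union> Q')"
    using Q'(1) by (auto simp: triangle_packing_def intro: pairwise_subset)
  then show ?thesis using hit2[OF U c] Q'(2,3) by blast
next
  assume "card (U \<inter> M) = 3"
  then show ?thesis using hit3[OF U _ Q'] by blast
qed

lemma hit_false:
  assumes "U \<in> triangles E" "triangle_packing E (S \<union> Q' \<union> Z)" "\<And>T. T \<in> Q' \<Longrightarrow> card (T \<inter> M) = 2"
    "card Q' = card Q" "U \<inter> \<Union>S = {}" "U \<inter> \<Union>Q' = {}" "U \<inter> \<Union>Z = {}"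
  shows False
  using hit_all[OF assms(1-4)] assms(5-7) by (simp add: Int_Un_distrib)

text \<open>Two such triangles through different edges of \<open>A\<close> cannot be disjoint, as they could replace
  \<open>A\<close> in \<open>S\<close>; so if both edges occur, all of them have the same third vertex.\<close>

lemma single_common_edge:
  assumes A: "A \<in> S"
  shows "\<exists>g. \<forall>U\<in>triangles E. card (U \<inter> M) = 1 \<and> (\<exists>b\<in>A - M. U \<inter> \<Union>S = {b}) \<longrightarrow> g \<in> U"
proof -
  define X where "X = {U \<in> triangles E. card (U \<inter> M) = 1 \<and> (\<exists>b\<in>A - M. U \<inter> \<Union>S = {b})}"
  have At: "A \<in> triangles E" using A tri by auto
  have meet: "U1 \<inter> U2 \<noteq> {}" if U: "U1 \<in> X" "U2 \<in> X" "U1 \<noteq> U2" for U1 U2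
  proof
    assume "U1 \<inter> U2 = {}"
    then have d: "disjoint {U1, U2}" by (auto simp: disjoint_def)
    have sub: "W \<inter> \<Union>S \<subseteq> A" if W: "W \<in> X" for W
    proof -
      obtain b where "b \<in> A - M" "W \<inter> \<Union>S = {b}" using W by (auto simp: X_def)
      then show ?thesis by simp
    qed
    have "A \<in> S \<and> T \<inter> \<Union>S \<subseteq> A" if "T \<in> {U1, U2}" for T
      using that sub[OF U(1)] sub[OF U(2)] A by auto
    \<comment> \<open>Both triangles take the place of \<open>A\<close>, hence the constant
      owner.\<close>
    from swap_disjoint[where own = "\<lambda>_. A", OF disj(2) d this]
    have "disjoint (S - (\<lambda>_. A) ` {U1, U2} \<union> {U1, U2})" .
    then have "triangle_packing E (S - {A} \<union> {U1, U2})"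
      using U tri unfolding triangle_packing_def X_def by auto
    moreover have "card (T \<inter> M) = 1" if "T \<in> S - {A} \<union> {U1, U2}" for T
      using that S1 U by (auto simp: X_def)
    ultimately have "card (S - {A} \<union> {U1, U2}) \<le> card S" by (rule maxS)
    moreover have "W \<notin> S" if "W \<in> X" for W
    proof
      assume "W \<in> S"
      then have "W \<inter> \<Union>S = W" by auto
      then show False using that triangle_card(1)[of W E] by (auto simp: X_def)
    qed
    then have "U1 \<notin> S" "U2 \<notin> S" using U by auto
    moreover have "S - {A} \<union> {U1, U2} = insert U1 (insert U2 (S - {A}))" by auto
    ultimately show False using U(3) A fin card_gt_0_iff[of S] by (auto simp: card_Diff_singleton)
  qed
  have AM: "card (A \<inter> - M) = 2" using card_Diff_triangle(1)[OF At S1[OF A]] by simp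
  show ?thesis
  proof (cases "\<exists>b. \<forall>U\<in>X. b \<in> U")
    case True
    then obtain b where "\<forall>U\<in>X. b \<in> U" by blast
    then show ?thesis by (intro exI[of _ b]) (auto simp: X_def)
  next
    case False
    then obtain U1 where U1: "U1 \<in> X" by auto
    then obtain b1 where b1: "b1 \<in> A - M" "U1 \<inter> \<Union>S = {b1}" by (auto simp: X_def)
    obtain U2 where U2: "U2 \<in> X" "b1 \<notin> U2" using False by auto
    then obtain b2 where b2: "b2 \<in> A - M" "U2 \<inter> \<Union>S = {b2}" by (auto simp: X_def)
    have b12: "b1 \<noteq> b2" using U2 b2 by auto
    have "{b1, b2} = A \<inter> - M"
      using b1 b2 b12 AM by (intro card_subset_eq) (auto intro: card_ge_0_finite)
    then have bb: "b = b1 \<or> b = b2" if "b \<in> A - M" for b using that by auto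
    have UA: "W \<inter> A = {b}" if "W \<inter> \<Union>S = {b}" "b \<in> A - M" for W b using that A by blast
    have "U1 \<noteq> U2" using U2(2) b1 by auto
    \<comment> \<open>A member of \<open>X\<close> is determined by its edge in \<open>A\<close> and
      the common third vertex, so \<open>X\<close> consists of \<open>U1\<close> and
      \<open>U2\<close> only, and any edge shared by these two will do.\<close>
    then obtain g where g: "g \<in> U1" "g \<in> U2" using meet[OF U1 U2(1)] by auto
    have t: "U1 \<in> triangles E" "U2 \<in> triangles E" using U1 U2 by (auto simp: X_def)
    have "g \<in> U" if U: "U \<in> X" for U
    proof -
      have Ut: "U \<in> triangles E" using U by (auto simp: X_def)
      obtain b where b: "b \<in> A - M" "U \<inter> \<Union>S = {b}" using U by (auto simp: X_def)
      show ?thesis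
      proof (cases "b = b1")
        case True
        then have "U \<noteq> U2" using b U2 by auto
        then have "\<Union>U = b1 \<union> (\<Union>U2 - \<Union>A)"
          using page_unique[OF At b12 Ut _ t(2) _ meet[OF U U2(1)]] UA[OF b(2,1)] UA[OF b2(2,1)] True by simp
        moreover have "\<Union>U1 = b1 \<union> (\<Union>U2 - \<Union>A)"
          using page_unique[OF At b12 t(1) _ t(2) _ meet[OF U1 U2(1)]] UA[OF b1(2,1)] UA[OF b2(2,1)]
            \<open>U1 \<noteq> U2\<close> by simp
        ultimately show ?thesis using triangle_eqI[OF Ut t(1)] g by simp
      next
        case False
        then have bb2: "b = b2" using bb b by auto
        then have "U \<noteq> U1" using b b1 b12 by auto
        then have "\<Union>U = b2 \<union> (\<Union>U1 - \<Union>A)"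
          using page_unique[OF At b12[symmetric] Ut _ t(1) _ meet[OF U U1]] UA[OF b(2,1)] UA[OF b1(2,1)] bb2
          by simp
        moreover have "\<Union>U2 = b2 \<union> (\<Union>U1 - \<Union>A)"
          using page_unique[OF At b12[symmetric] t(2) _ t(1) _ meet[OF U2(1) U1]] UA[OF b1(2,1)] UA[OF b2(2,1)]
            \<open>U1 \<noteq> U2\<close> by simp
        ultimately show ?thesis using triangle_eqI[OF Ut t(2)] g by simp
      qed
    qed
    then show ?thesis by (intro exI[of _ g]) (auto simp: X_def)
  qed
qed

section \<open>Pages and their exchange with owners\<close>

definition page :: "'a set set \<Rightarrow> bool" where
  "page T \<longleftrightarrow> T \<in> triangles E \<and> card (T \<inter> M) = 2 \<and> T \<inter> \<Union>S = {} \<and> T \<inter> \<Union>Z = {} \<and>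
     T \<inter> M \<inter> \<Union>Q = {} \<and> T \<inter> \<Union>Q \<noteq> {}"

lemma Union_E: "\<Union>S \<subseteq> E" "\<Union>Q \<subseteq> E" "\<Union>Z \<subseteq> E"
  using tri triE by blast+

lemma pageD:
  assumes "page T"
  shows "T \<in> triangles E" "card (T \<inter> M) = 2" "T \<inter> \<Union>S = {}" "T \<inter> \<Union>Z = {}"
    "T \<inter> M \<inter> \<Union>Q = {}" "T \<inter> \<Union>Q \<noteq> {}"
  using assms unfolding page_def by blast+

text \<open>The page and its owner \<open>D\<close> have type 2, so each has exactly one edge
  outside \<open>M\<close>. Since the page avoids \<open>\<Union>Q\<close> inside \<open>M\<close>,
  the common edge is this edge for both.\<close>

lemma page_spine:
  assumes T: "page T"
  obtains n D where "D \<in> Q" "T \<inter> \<Union>Q = {n}" "D \<inter> T = {n}" "n \<notin> M" "T \<inter> - M = {n}" "D \<inter> - M = {n}"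
proof -
  have "card (T \<inter> - M) = 1" using card_Diff_triangle(1)[OF pageD(1,2)[OF T]] by simp
  then obtain n where n: "T \<inter> - M = {n}" by (auto simp: card_1_singleton_iff)
  have Tn': "e = n" if "e \<in> T" "e \<notin> M" for e using n that by auto
  have "T \<inter> \<Union>Q \<subseteq> {n}" using Tn' pageD(5)[OF T] by blast
  then have Tn: "T \<inter> \<Union>Q = {n}" using pageD(6)[OF T] by blast
  then have "n \<in> \<Union>Q" by auto
  then obtain D where D: "D \<in> Q" "n \<in> D" by blast
  have "card (D \<inter> - M) = 1" using card_Diff_triangle(1)[of D E, OF _ Q2[OF D(1)]] tri D by auto
  then obtain k where k: "D \<inter> - M = {k}" by (auto simp: card_1_singleton_iff)
  have nM: "n \<notin> M" "n \<in> T" using n by auto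
  then have "n = k" using k D(2) by auto
  then have Dn: "D \<inter> - M = {n}" using k by simp
  have "D \<inter> T \<subseteq> {n}" using Tn D(1) by auto
  then have "D \<inter> T = {n}" using D(2) nM(2) by blast
  then show ?thesis using that[OF D(1) Tn _ nM(1) n Dn] by simp
qed

lemma page_notin:
  assumes T: "page T" shows "T \<notin> Q"
proof
  assume "T \<in> Q"
  moreover obtain n where "T \<inter> \<Union>Q = {n}" by (rule page_spine[OF T])
  moreover have "T \<inter> \<Union>Q = T" using \<open>T \<in> Q\<close> by blast
  ultimately have "card T = 1" by simp
  then show False using triangle_card(1)[OF pageD(1)[OF T]] by simp
qed

text \<open>A page has the type of its owner and meets the chosen packing only there, so the
  exchange preserves all that the \<open>hit\<close> lemmas ask of \<open>Q'\<close>. The owner map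
  is a parameter because \<open>no_second_page\<close> needs a modified one.\<close>

lemma swap_pages:
  assumes J: "disjoint J" "\<And>T. T \<in> J \<Longrightarrow> page T" "inj_on own J"
    and own: "\<And>T. T \<in> J \<Longrightarrow> own T \<in> Q \<and> T \<inter> \<Union>Q \<subseteq> own T"
  shows "triangle_packing E (S \<union> (Q - own ` J \<union> J) \<union> Z)"
    "T \<in> Q - own ` J \<union> J \<Longrightarrow> card (T \<inter> M) = 2" "card (Q - own ` J \<union> J) = card Q"
proof -
  have finJ: "finite J" using packing_finite[OF finE, of J] J(2) pageD(1) by blast
  have own': "own T \<in> S \<union> Q \<union> Z \<and> T \<inter> \<Union>(S \<union> Q \<union> Z) \<subseteq> own T" if "T \<in> J" for T
    using own[OF that] pageD(3,4)[OF J(2)[OF that]] by blast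
  have "S \<union> (Q - own ` J \<union> J) \<union> Z = S \<union> Q \<union> Z - own ` J \<union> J"
    using own distinct_types by blast
  moreover have "disjoint (S \<union> Q \<union> Z - own ` J \<union> J)"
    by (rule swap_disjoint[OF disj(5) J(1) own'])
  moreover have "J \<subseteq> triangles E" using J(2) pageD(1) by auto
  then have "S \<union> (Q - own ` J \<union> J) \<union> Z \<subseteq> triangles E" using tri by auto
  ultimately show "triangle_packing E (S \<union> (Q - own ` J \<union> J) \<union> Z)"
    unfolding triangle_packing_def by simp
  show "card (T \<inter> M) = 2" if T: "T \<in> Q - own ` J \<union> J"
  proof (cases "T \<in> J")
    case True
    then show ?thesis by (intro pageD(2) J(2))
  next
    case False
    then show ?thesis using T by (intro Q2) auto
  qed
  show "card (Q - own ` J \<union> J) = card Q"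
  proof (rule swap_card[OF fin(3) finJ J(3)])
    show "own T \<in> Q \<and> T \<notin> Q" if "T \<in> J" for T
      using own[OF that] page_notin[OF J(2)[OF that]] by simp
  qed
qed

end

section \<open>A maximal disjoint family of pages\<close>

locale lex_pages = lex_packing +
  fixes R and own :: "'a set set \<Rightarrow> 'a set set" and sp :: "'a set set \<Rightarrow> 'a set"
  assumes pageR: "T \<in> R \<Longrightarrow> page T" and disjR: "disjoint R"
    and maxR: "page T \<Longrightarrow> T \<inter> \<Union>R \<noteq> {}"
    and ownR: "T \<in> R \<Longrightarrow> own T \<in> Q \<and> T \<inter> \<Union>Q = {sp T} \<and> own T \<inter> T = {sp T} \<and> sp T \<notin> M
      \<and> T \<inter> - M = {sp T} \<and> own T \<inter> - M = {sp T}"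
begin

lemma triR: "R \<subseteq> triangles E" using pageR pageD(1) by blast
lemma finR: "finite R" by (rule packing_finite[OF finE triR])

lemma ownQ: "T \<in> R \<Longrightarrow> own T \<in> Q"
  and spQ: "T \<in> R \<Longrightarrow> T \<inter> \<Union>Q = {sp T}"
  and own_Int: "T \<in> R \<Longrightarrow> own T \<inter> T = {sp T}"
  and sp_M: "T \<in> R \<Longrightarrow> sp T \<notin> M"
  and spT: "T \<in> R \<Longrightarrow> T \<inter> - M = {sp T}"
  and sp_own: "T \<in> R \<Longrightarrow> own T \<inter> - M = {sp T}"
  using ownR by auto

lemma own_tri: "T \<in> R \<Longrightarrow> own T \<in> triangles E" using ownQ tri by blast

lemma inj_sp: "T \<in> R \<Longrightarrow> U \<in> R \<Longrightarrow> sp T = sp U \<Longrightarrow> T = U"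
  using disjointD[OF disjR, of T U] own_Int[of T] own_Int[of U] by auto

text \<open>An owner has only one edge outside \<open>M\<close>, and disjoint pages cannot share
  it.\<close>

lemma inj_own: "inj_on own R"
proof (rule inj_onI)
  fix T U assume TU: "T \<in> R" "U \<in> R" "own T = own U"
  then have "{sp T} = {sp U}" using sp_own by metis
  then show "T = U" using inj_sp TU by simp
qed

lemma swap_R:
  assumes "J \<subseteq> R"
  shows "triangle_packing E (S \<union> (Q - own ` J \<union> J) \<union> Z)"
    "T \<in> Q - own ` J \<union> J \<Longrightarrow> card (T \<inter> M) = 2" "card (Q - own ` J \<union> J) = card Q"
proof -
  have "disjoint J" "inj_on own J" using assms disjR inj_own by (auto intro: pairwise_subset inj_on_subset)
  moreover have "own T \<in> Q \<and> T \<inter> \<Union>Q \<subseteq> own T" if "T \<in> J" for T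
  proof -
    have T: "T \<in> R" using assms that by auto
    show ?thesis unfolding spQ[OF T] using ownQ[OF T] own_Int[OF T] by auto
  qed
  moreover have "page T" if "T \<in> J" for T using assms that pageR by auto
  ultimately show "triangle_packing E (S \<union> (Q - own ` J \<union> J) \<union> Z)"
    "T \<in> Q - own ` J \<union> J \<Longrightarrow> card (T \<inter> M) = 2" "card (Q - own ` J \<union> J) = card Q"
    using swap_pages[of J own] by blast+
qed

text \<open>Edges that count as paid for: by \<open>spines\<close>, the cover of
  \<open>cover_swap_bound\<close> contains them all. A sixth edge outside \<open>base\<close> avoids
  \<open>S\<close>, \<open>Z\<close> and the members of \<open>Q\<close> without a page, which
  \<open>no_second_page\<close> exploits.\<close>

definition base :: "'a set set" where
  "base = \<Union>S \<union> \<Union>Z \<union> (\<Union>Q - M) \<union> \<Union>(Q - own ` R)"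

text \<open>The pages that cost an extra edge in the cover of \<open>cover_swap_bound\<close>.\<close>

definition K :: "'a set set set" where
  "K = {T \<in> R. opp (own T) T \<in> E \<and> opp (own T) T \<notin> base}"

abbreviation oppK :: "'a set set" where "oppK \<equiv> (\<lambda>T. opp (own T) T) ` K"

lemma K_R: "K \<subseteq> R" by (auto simp: K_def)
lemma finK: "finite K" using K_R finR by (rule finite_subset)
lemma card_K: "card K \<le> card R" using K_R finR by (intro card_mono)
lemma card_R: "card R \<le> card Q" using card_inj_on_le[OF inj_own _ fin(3)] ownQ by blast
lemma card_unpaged: "card (Q - own ` R) = card Q - card R"
proof -
  have "own ` R \<subseteq> Q" using ownQ by auto
  from card_Diff_subset[OF finite_imageI[OF finR] this] show ?thesis using card_image[OF inj_own] by simp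
qed
lemma card_oppK: "card oppK \<le> card K" by (rule card_image_le[OF finK])
lemma oppK_E: "oppK \<subseteq> E" by (auto simp: K_def)

lemma both_sides:
  assumes T: "T \<in> R" and U: "U \<in> triangles E" "sp T \<notin> U" and m: "m \<in> U \<inter> own T" and f: "f \<in> U \<inter> T"
  shows "opp (own T) T \<in> U"
proof (rule opp_in[OF own_tri[OF T] _ own_Int[OF T] U(1) m _ f])
  show "T \<in> triangles E" using T triR by auto
  show "m \<noteq> sp T" "f \<noteq> sp T" using m f U(2) by auto
qed

text \<open>The only edge outside \<open>M\<close> of an owner is the one shared with its
  page.\<close>

lemma spines: "\<Union>Q - M \<subseteq> \<Union>(Q - own ` R) \<union> sp ` R"
proof
  fix e assume "e \<in> \<Union>Q - M"
  then obtain D where D: "D \<in> Q" "e \<in> D" "e \<notin> M" by blast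
  show "e \<in> \<Union>(Q - own ` R) \<union> sp ` R"
  proof (cases "D \<in> own ` R")
    case True
    then obtain T where "T \<in> R" "D = own T" by auto
    then have "e \<in> own T \<inter> - M" using D by simp
    then have "e = sp T" using sp_own[OF \<open>T \<in> R\<close>] by simp
    then show ?thesis using \<open>T \<in> R\<close> by simp
  qed (use D in blast)
qed

text \<open>An owner with a page costs the common edge instead of three edges, plus the sixth edge
  for pages in \<open>K\<close>. A triangle off the cover misses the page or the owner in each pair,
  so it avoids an exchanged packing, against \<open>hit_false\<close>.\<close>

lemma cover_swap_bound:
  "tau E + 2 * card R \<le> 3 * card S + 3 * card Q + 3 * card Z + card K"
proof -
  define C where "C = \<Union>S \<union> \<Union>Z \<union> \<Union>(Q - own ` R) \<union> sp ` R \<union> oppK"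
  have spE: "sp ` R \<subseteq> E"
  proof (intro image_subsetI)
    fix T assume "T \<in> R"
    then have "sp T \<in> T" "T \<subseteq> E" using own_Int[of T] triR triE by blast+
    then show "sp T \<in> E" by blast
  qed
  have CE: "C \<subseteq> E" unfolding C_def using spE oppK_E Union_E by auto
  have "triangle_cover E C"
    unfolding triangle_cover_def
  proof (intro conjI CE ballI notI)
    fix U assume U: "U \<in> triangles E" and "C \<inter> U = {}"
    then have CU: "U \<inter> \<Union>S = {}" "U \<inter> \<Union>Z = {}" "U \<inter> \<Union>(Q - own ` R) = {}" "U \<inter> sp ` R = {}" "U \<inter> oppK = {}"
      unfolding C_def by blast+
    define J where "J = {T \<in> R. U \<inter> own T \<noteq> {}}"
    have JR: "J \<subseteq> R" by (auto simp: J_def)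
    have "U \<inter> own T = {} \<or> U \<inter> T = {}" if T: "T \<in> R" for T
    proof (rule ccontr)
      assume "\<not> ?thesis"
      then obtain m f where mf: "m \<in> U \<inter> own T" "f \<in> U \<inter> T" by blast
      have "sp T \<notin> U" using CU(4) T by blast
      from both_sides[OF T U this mf] have o: "opp (own T) T \<in> U" .
      \<comment> \<open>For a page outside \<open>K\<close>, a sixth edge in \<open>E\<close> lies
        in \<open>base\<close>, which \<open>U\<close> avoids.\<close>
      have "T \<notin> K" using CU(5) o by blast
      then have "opp (own T) T \<in> base" using T o triE[OF U] by (auto simp: K_def)
      moreover have "U \<inter> (\<Union>Q - M) = {}" using spines CU(3,4) by blast
      then have "U \<inter> base = {}" using CU(1-3) unfolding base_def by blast
      ultimately show False using o by blast
    qed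
    then have "U \<inter> \<Union>(Q - own ` J \<union> J) = {}"
      unfolding J_def using CU(3) by (intro swap_avoids)
    from hit_false[OF U swap_R(1)[OF JR] swap_R(2)[OF JR] swap_R(3)[OF JR] CU(1) this CU(2)]
    show False .
  qed
  then have "tau E \<le> card C" by (rule tau_attained(2)[OF finE])
  also have "card C \<le> card (\<Union>S) + card (\<Union>Z) + card (\<Union>(Q - own ` R)) + card (sp ` R) + card oppK"
    unfolding C_def by (intro order_trans[OF card_Un_le] add_mono order_refl)
  also have "\<dots> \<le> 3 * card S + 3 * card Z + 3 * (card Q - card R) + card R + card K"
    using card_Union_triangles[OF fin(2) tri(2)] card_Union_triangles[OF fin(4) tri(4)]
      card_Union_triangles[of "Q - own ` R" E] fin tri card_image_le[OF finR, of sp] card_oppK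
    unfolding card_unpaged[symmetric] by (intro add_mono) auto
  finally show ?thesis using card_R by simp
qed

end

section \<open>Covers\<close>

context lex_pages
begin

text \<open>A second page \<open>U\<close> on the same edge could take the place of the owner \<open>D\<close>; this frees the triangle
  formed by the sixth edge \<open>e\<close> with one edge of \<open>D\<close> and one of \<open>T\<close>. If \<open>e\<close> belongs to the owner
  of another page, then that owner is exchanged as well.\<close>

lemma no_second_page:
  assumes T: "T \<in> K" and U: "page U" "sp T \<in> U" "U \<inter> \<Union>R \<inter> M = {}"
  shows False
proof -
  define D where "D = own T"
  define e where "e = opp D T"
  have TR: "T \<in> R" and eE: "e \<in> E" and eb: "e \<notin> base" using T by (auto simp: K_def D_def e_def)
  have Dt: "D \<in> triangles E" and Tt: "T \<in> triangles E" and DQ: "D \<in> Q" and DT: "D \<inter> T = {sp T}"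
    using own_tri[OF TR] triR TR ownQ[OF TR] own_Int[OF TR] by (auto simp: D_def)
  have Ut: "U \<in> triangles E" using pageD(1)[OF U(1)] .
  obtain m f where mf: "m \<in> D" "m \<noteq> sp T" "f \<in> T" "f \<noteq> sp T" and W: "{m, f, e} \<in> triangles E"
    using opp_triangle[OF Dt Tt DT] eE unfolding e_def by metis
  have eU: "e \<notin> U" unfolding e_def by (rule opp_notin[OF Dt Tt DT Ut U(2)])
  have mM: "m \<in> M" using mf(1,2) sp_own[OF TR] by (auto simp: D_def)
  have fM: "f \<in> M" using mf(3,4) spT[OF TR] by auto
  have e_eb: "e \<notin> \<Union>S" "e \<notin> \<Union>Z" "e \<notin> \<Union>Q - M" "e \<notin> \<Union>(Q - own ` R)"
    using eb unfolding base_def by blast+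
  have UR: "U \<notin> R"
  proof
    assume "U \<in> R"
    then have "U \<inter> M = {}" using U(3) by blast
    then show False using hit0[OF Ut] by contradiction
  qed
  obtain n where n: "U \<inter> \<Union>Q = {n}" "U \<inter> - M = {n}" by (rule page_spine[OF U(1)])
  have nT: "n = sp T" using n(2) U(2) sp_M[OF TR] by auto
  \<comment> \<open>\<open>U\<close> replaces \<open>D\<close>. Owners are disjoint, so at most one
    further page is exchanged, the one whose owner contains \<open>e\<close>; the set form also
    covers the case of none.\<close>
  define J where "J = insert U {T' \<in> R - {T}. e \<in> own T'}"
  \<comment> \<open>As \<open>U\<close> is not in \<open>R\<close>, the update changes no owner of a
    page in \<open>R\<close>. \<open>T\<close> also has owner \<open>D\<close>, but it is left out
    of \<open>J\<close>.\<close>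
  define own' where "own' = own(U := D)"
  have ownU: "own' U = D" and ownT: "own' T' = own T'" if "T' \<in> R" for T'
    using UR that by (auto simp: own'_def)
  have JR: "T' \<in> R" "T' \<noteq> T" "e \<in> own T'" if "T' \<in> J" "T' \<noteq> U" for T'
    using that by (auto simp: J_def)
  \<comment> \<open>Inside \<open>M\<close> this is the hypothesis on \<open>U\<close>; outside
    \<open>M\<close> a page has a single edge, and that of \<open>U\<close> belongs to
    \<open>T\<close>.\<close>
  have UT': "U \<inter> T' = {}" if T': "T' \<in> J" "T' \<noteq> U" for T'
  proof (rule ccontr)
    assume "U \<inter> T' \<noteq> {}"
    then obtain x where x: "x \<in> U" "x \<in> T'" by blast
    have "x \<notin> M" using x U(3) JR(1)[OF T'] by blast
    then have "x = sp T'" "x = sp T" using x n(2) nT spT[OF JR(1)[OF T']] by auto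
    then show False using inj_sp[OF JR(1)[OF T'] TR] JR(2)[OF T'] by simp
  qed
  have disjJ: "disjoint J"
  proof (rule disjointI)
    fix A B assume AB: "A \<in> J" "B \<in> J" "A \<noteq> B"
    show "A \<inter> B = {}"
    proof (cases "A = U \<or> B = U")
      case True
      then show ?thesis using AB UT'[of A] UT'[of B] by auto
    next
      case False
      then show ?thesis using disjointD[OF disjR JR(1)[of A] JR(1)[of B]] AB by blast
    qed
  qed
  have pageJ: "page T'" if "T' \<in> J" for T' using that U(1) pageR JR(1) by metis
  have injJ: "inj_on own' J"
  proof (rule inj_onI)
    fix A B assume AB: "A \<in> J" "B \<in> J" "own' A = own' B"
    have *: "own' A \<noteq> D" if "A \<in> J" "A \<noteq> U" for A
    proof
      assume "own' A = D"
      then have "own A = own T" using ownT[OF JR(1)[OF that]] by (simp add: D_def)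
      then show False using inj_onD[OF inj_own _ JR(1)[OF that] TR] JR(2)[OF that] by simp
    qed
    show "A = B"
    proof (cases "A = U \<or> B = U")
      case True
      then show ?thesis using AB *[of A] *[of B] ownU[OF TR] by auto
    next
      case False
      then have R: "A \<in> R" "B \<in> R" using AB JR(1) by auto
      then have "own A = own B" using AB(3) ownT by simp
      then show ?thesis using inj_onD[OF inj_own _ R] by simp
    qed
  qed
  have ownJ: "own' T' \<in> Q \<and> T' \<inter> \<Union>Q \<subseteq> own' T'" if T': "T' \<in> J" for T'
  proof (cases "T' = U")
    case True
    then show ?thesis using DQ n(1) nT DT ownU[OF TR] by auto
  next
    case False
    then have "T' \<in> R" using JR(1) T' by simp
    then show ?thesis using ownQ spQ own_Int[of T'] ownT by auto
  qed
  define Q' where "Q' = Q - own' ` J \<union> J"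
  have DJ: "D \<in> own' ` J" using ownU[OF TR] by (force simp: J_def)
  have meet: False if "x \<in> {m, f, e}" "A \<in> Q'" "x \<in> A" for x A
  proof -
    consider "A \<in> Q" "A \<notin> own' ` J" | "A = U" | "A \<in> J" "A \<noteq> U"
      using \<open>A \<in> Q'\<close> unfolding Q'_def by blast
    then show False
    proof cases
      case 1
      have "A \<noteq> D" using 1(2) DJ by blast
      have "x \<noteq> m" using disjointD[OF disj(3) 1(1) DQ \<open>A \<noteq> D\<close>] mf(1) \<open>x \<in> A\<close> by blast
      moreover have "x \<noteq> f" using pageD(5)[OF pageR[OF TR]] mf(3) fM \<open>x \<in> A\<close> 1(1) by blast
      ultimately have "e \<in> A" using that by blast
      then have "A \<in> own ` R" using e_eb(4) 1(1) by blast
      then obtain T' where T': "T' \<in> R" "A = own T'" by blast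
      then have "T' \<noteq> T" using \<open>A \<noteq> D\<close> by (auto simp: D_def)
      then have "T' \<in> J" using T' \<open>e \<in> A\<close> by (simp add: J_def)
      then show False using 1(2) T' ownT[OF T'(1)] by (metis image_eqI)
    next
      case 2
      have "x \<noteq> m" using pageD(5)[OF U(1)] mM mf(1) DQ \<open>x \<in> A\<close> 2 by blast
      moreover have "x \<noteq> f" using U(3) fM mf(3) TR \<open>x \<in> A\<close> 2 by blast
      ultimately show False using that 2 eU by blast
    next
      case 3
      note A = JR[OF 3]
      have "x \<noteq> m" using pageD(5)[OF pageR[OF A(1)]] mM mf(1) DQ \<open>x \<in> A\<close> by blast
      moreover have "x \<noteq> f" using disjointD[OF disjR A(1) TR A(2)] mf(3) \<open>x \<in> A\<close> by blast
      ultimately have "e \<in> own A \<inter> A" using that A(3) by blast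
      \<comment> \<open>A replacing page shares only \<open>sp A\<close> with its owner, and that
        edge lies in \<open>\<Union>Q - M\<close>, hence in \<open>base\<close>.\<close>
      then have "e = sp A" using own_Int[OF A(1)] by blast
      then show False using sp_M[OF A(1)] A(3) ownQ[OF A(1)] e_eb(3) by blast
    qed
  qed
  have "m \<in> \<Union>Q" using mf(1) DQ by blast
  then have "m \<notin> \<Union>S" "m \<notin> \<Union>Z" using SQ_disj by blast+
  moreover have "f \<notin> \<Union>S" "f \<notin> \<Union>Z" using pageD(3,4)[OF pageR[OF TR]] mf(3) by blast+
  ultimately have "{m, f, e} \<inter> \<Union>S = {}" "{m, f, e} \<inter> \<Union>Z = {}" using e_eb by blast+
  moreover have "{m, f, e} \<inter> \<Union>Q' = {}" using meet by blast
  ultimately show False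
    using hit_false[OF W swap_pages[OF disjJ pageJ injJ ownJ]] unfolding Q'_def by blast
qed

text \<open>A triangle off this cover is a page. By maximality it shares an edge with a page of
  \<open>R\<close>; this edge lies outside \<open>M\<close>, so it is the uncovered
  \<open>sp T\<close> of some \<open>T\<close> in \<open>K\<close>, and
  \<open>no_second_page\<close> applies. The saving is these \<open>card K\<close> omitted
  edges.\<close>

lemma cover_double_bound:
  "tau E + card K \<le> 3 * card S + 2 * card Q + 3 * card Z + 3 * card R"
proof -
  define C where "C = \<Union>S \<union> \<Union>Z \<union> (\<Union>Q \<inter> M) \<union> (\<Union>R \<inter> M) \<union> sp ` (R - K)"
  have "sp ` (R - K) \<subseteq> E"
  proof (intro image_subsetI)
    fix T assume T: "T \<in> R - K"
    then have "sp T \<in> T" using own_Int[of T] by auto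
    moreover have "T \<subseteq> E" using triR triE T by blast
    ultimately show "sp T \<in> E" by blast
  qed
  then have CE: "C \<subseteq> E" unfolding C_def using Union_E ME by (intro Un_least) auto
  have "triangle_cover E C"
    unfolding triangle_cover_def
  proof (intro conjI CE ballI notI)
    fix U assume U: "U \<in> triangles E" and "C \<inter> U = {}"
    then have CU: "U \<inter> \<Union>S = {}" "U \<inter> \<Union>Z = {}" "U \<inter> M \<inter> \<Union>Q = {}" "U \<inter> \<Union>R \<inter> M = {}" "U \<inter> sp ` (R - K) = {}"
      unfolding C_def by blast+
    have "U \<inter> \<Union>Q \<noteq> {}"
      using hit_false[OF U pack Q2 refl CU(1) _ CU(2)] by blast
    show False
    proof (rule type_cases[OF U])
      assume "card (U \<inter> M) = 1"
      then show False using hit1[OF U] CU(1) by simp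
    next
      assume "card (U \<inter> M) = 2"
      then have pU: "page U" unfolding page_def using U CU \<open>U \<inter> \<Union>Q \<noteq> {}\<close> by simp
      then obtain x T where x: "x \<in> U" "x \<in> T" "T \<in> R" using maxR by blast
      then have "x \<notin> M" using CU(4) by blast
      then have "x = sp T" using spT[OF x(3)] x(2) by auto
      moreover from this have "T \<in> K" using CU(5) x by blast
      ultimately show False using no_second_page[OF _ pU _ CU(4)] x(1) by blast
    next
      assume "card (U \<inter> M) = 3"
      then have "U \<inter> M = U" using triangle_card(1,2)[OF U] by (intro card_subset_eq) auto
      then show False using CU(3) \<open>U \<inter> \<Union>Q \<noteq> {}\<close> by simp
    qed
  qed
  then have "tau E \<le> card C" by (rule tau_attained(2)[OF finE])
  also have "card C \<le> card (\<Union>S) + card (\<Union>Z) + card (\<Union>Q \<inter> M) + card (\<Union>R \<inter> M) + card (sp ` (R - K))"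
    unfolding C_def by (intro order_trans[OF card_Un_le] add_mono order_refl)
  also have "\<dots> \<le> 3 * card S + 3 * card Z + 2 * card Q + 2 * card R + card (R - K)"
    using card_Union_triangles[OF fin(2) tri(2)] card_Union_triangles[OF fin(4) tri(4)]
      card_Union_Int[OF fin(3), of M 2] Q2 card_Union_Int[OF finR, of M 2] pageD(2)[OF pageR]
      card_image_le[of "R - K" sp] finR
    by (intro add_mono) auto
  also have "card (R - K) = card R - card K" using finK K_R by (rule card_Diff_subset)
  finally show ?thesis using card_K by simp
qed

text \<open>The edges in \<open>M\<close> of \<open>S\<close> and of the unpaged members of
  \<open>Q\<close> are bought fully; most others go into a graph \<open>H\<close> of which half
  suffices. A triangle of type 2 that leaves \<open>H\<close> avoids \<open>S\<close> and, once the
  owners it hits are exchanged for their pages, also the new \<open>Q\<close>, against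
  \<open>hit2\<close>.\<close>

lemma cover_half_bound:
  "2 * tau E + 2 * card R \<le> 3 * card P + 4 * card S + 3 * card Q + card K"
proof -
  define Y where "Y = \<Union>(Q - own ` R)"
  define H where "H = (M - \<Union>S - Y) \<union> (\<Union>S - M) \<union> (\<Union>Q - M) \<union> oppK"
  obtain g where g: "\<And>A U. A \<in> S \<Longrightarrow> U \<in> triangles E \<Longrightarrow> card (U \<inter> M) = 1 \<Longrightarrow>
      \<exists>b\<in>A - M. U \<inter> \<Union>S = {b} \<Longrightarrow> g A \<in> U"
    using single_common_edge by metis
  define G where "G = g ` S \<inter> E"
  define H' where "H' = (H - G) \<union> (G - H)"
  have HE: "H \<subseteq> E" unfolding H_def using Union_E ME oppK_E by blast
  have finH: "finite H" and finG: "finite G" using HE finE fin by (auto simp: G_def intro: finite_subset)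
  have "\<forall>e\<in>H'. e \<subseteq> V \<and> card e = 2" "finite V" "finite H'"
    using HE graph finH finG by (auto simp: H'_def G_def finite_simple_graph_def)
  then obtain C' where C': "C' \<subseteq> H'" "2 * card C' \<le> card H'"
    "\<And>U. U \<in> triangles E \<Longrightarrow> U \<subseteq> H' \<Longrightarrow> U \<inter> C' \<noteq> {}"
    using half_cover[of V H' E] by metis
  define C where "C = (\<Union>S \<inter> M) \<union> (Y \<inter> M) \<union> (G \<inter> H) \<union> C'"
  have CE: "C \<subseteq> E" unfolding C_def using ME HE C'(1) by (auto simp: H'_def G_def)
  \<comment> \<open>A triangle of type 1 with two edges in \<open>H\<close> contains the common edge \<open>g A\<close> of its \<open>A\<close>; this
    costs half an edge more, either to take \<open>g A\<close> fully or to add it to the halved graph.\<close>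
  have "triangle_cover E C"
    unfolding triangle_cover_def
  proof (intro conjI CE ballI notI)
    fix U assume U: "U \<in> triangles E" and "C \<inter> U = {}"
    then have CU: "U \<inter> M \<inter> \<Union>S = {}" "U \<inter> M \<inter> Y = {}" "U \<inter> G \<inter> H = {}" "U \<inter> C' = {}"
      unfolding C_def by blast+
    have UM: "U \<inter> M \<subseteq> H" using CU(1,2) unfolding H_def by blast
    have UH: "\<not> U \<subseteq> H"
    proof
      assume "U \<subseteq> H"
      then have "U \<subseteq> H'" using CU(3) unfolding H'_def by blast
      from C'(3)[OF U this] CU(4) show False by contradiction
    qed
    show False
    proof (rule type_cases[OF U])
      assume c: "card (U \<inter> M) = 1"
      obtain b A where b: "b \<in> U" "b \<in> A" "A \<in> S" using hit1[OF U c] by blast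
      have bM: "b \<notin> M" using CU(1) b by blast
      have card2: "card (U \<inter> - M) = 2" using card_Diff_triangle(1)[OF U c] by simp
      have "finite (U \<inter> - M)" using triangle_card(2)[OF U] by simp
      have "card (U \<inter> - M - {b}) = 1"
        using card2 b bM by (simp add: card_Diff_singleton)
      then obtain x where "U \<inter> - M - {b} = {x}" by (auto simp: card_1_singleton_iff)
      then have Ux: "U \<subseteq> (U \<inter> M) \<union> {b, x}" by blast
      have bH: "b \<in> H" using b bM unfolding H_def by blast
      have xH: "x \<notin> H" using Ux UM bH UH by blast
      have xM: "x \<in> U" "x \<notin> M" using \<open>U \<inter> - M - {b} = {x}\<close> by auto
      have "x \<notin> \<Union>S" using xH xM(2) unfolding H_def by blast
      then have "U \<inter> \<Union>S = {b}" using Ux CU(1) b by blast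
      then have gU: "g A \<in> U" using g[OF b(3) U c] b bM by blast
      then have "g A \<in> G" using b(3) triE[OF U] unfolding G_def by blast
      then have "g A \<notin> H" using gU CU(3) by blast
      then have "g A = x" using gU Ux UM bH by blast
      then have "U \<subseteq> H'"
        using Ux UM bH CU(3) \<open>g A \<in> G\<close> \<open>g A \<notin> H\<close> unfolding H'_def by blast
      from C'(3)[OF U this] CU(4) show False by contradiction
    next
      assume c: "card (U \<inter> M) = 2"
      then have "card (U \<inter> - M) = 1" using card_Diff_triangle(1)[OF U c] by simp
      then obtain x where x: "U \<inter> - M = {x}" by (auto simp: card_1_singleton_iff)
      then have Ux: "U \<subseteq> (U \<inter> M) \<union> {x}" and xU: "x \<in> U" "x \<notin> M" by auto
      have xH: "x \<notin> H" using Ux UM UH by blast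
      then have x': "x \<notin> \<Union>S" "x \<notin> \<Union>Q" "x \<notin> oppK" using xU unfolding H_def by blast+
      have US: "U \<inter> \<Union>S = {}" using CU(1) Ux x'(1) by blast
      have UY: "U \<inter> \<Union>(Q - own ` R) = {}" using CU(2) Ux x'(2) unfolding Y_def by blast
      define J where "J = {T \<in> R. U \<inter> own T \<noteq> {}}"
      have JR: "J \<subseteq> R" by (auto simp: J_def)
      have "U \<inter> own T = {} \<or> U \<inter> T = {}" if T: "T \<in> R" for T
      proof (rule ccontr)
        assume "\<not> ?thesis"
        then obtain m f where mf: "m \<in> U \<inter> own T" "f \<in> U \<inter> T" by blast
        define e where "e = opp (own T) T"
        have spQ': "sp T \<in> \<Union>Q" "sp T \<notin> M" using spQ[OF T] sp_M[OF T] by auto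
        have sU: "sp T \<notin> U" using spQ' Ux x'(2) by blast
        have eU: "e \<in> U" unfolding e_def by (rule both_sides[OF T U sU mf])
        have "e \<notin> own T" "e \<notin> T"
          using opp_notin[OF own_tri[OF T] _ own_Int[OF T]] own_tri[OF T] triR T own_Int[OF T]
          unfolding e_def by blast+
        then have ne: "m \<noteq> e" "f \<noteq> e" using mf by auto
        have mf': "m \<noteq> sp T" "f \<noteq> sp T" using mf sU by auto
        have "m \<noteq> f"
        proof
          assume "m = f"
          then have "m \<in> own T \<inter> T" using mf by simp
          then show False unfolding own_Int[OF T] using mf'(1) by simp
        qed
        have "m \<notin> own T \<inter> - M" "f \<notin> T \<inter> - M"
          unfolding sp_own[OF T] spT[OF T] using mf' by simp_all
        then have mfM: "m \<in> M" "f \<in> M" using mf by auto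
        \<comment> \<open>\<open>m\<close> and \<open>f\<close> are already two edges of
          \<open>U\<close> in \<open>M\<close>.\<close>
        have "e \<notin> M"
        proof
          assume "e \<in> M"
          then have "card {m, f, e} \<le> card (U \<inter> M)"
            using mf mfM eU triangle_card(2)[OF U] by (intro card_mono) auto
          then show False using ne \<open>m \<noteq> f\<close> c by simp
        qed
        then have "e = x" using eU Ux by blast
        \<comment> \<open>Edges of \<open>base\<close> lie in \<open>M\<close>,
          \<open>\<Union>S\<close> or \<open>\<Union>Q\<close>; so \<open>e\<close> would be one of
          the sixth edges put into \<open>H\<close>.\<close>
        moreover have "x \<notin> base" using x' xU(2) Z_M unfolding base_def by blast
        ultimately have "T \<in> K" using T eU triE[OF U] unfolding K_def e_def by blast
        then show False using x'(3) \<open>e = x\<close> unfolding e_def by blast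
      qed
      then have UQ: "U \<inter> \<Union>(Q - own ` J \<union> J) = {}"
        unfolding J_def using UY by (intro swap_avoids)
      have "triangle_packing E (S \<union> (Q - own ` J \<union> J))"
        using swap_R(1)[OF JR] by (auto simp: triangle_packing_def intro: pairwise_subset)
      from hit2[OF U c this swap_R(2)[OF JR] swap_R(3)[OF JR]] show False
        using US UQ by (simp add: Int_Un_distrib)
    next
      assume "card (U \<inter> M) = 3"
      then have "U \<inter> M = U" using triangle_card(1,2)[OF U] by (intro card_subset_eq) auto
      then show False using UM UH by simp
    qed
  qed
  then have "tau E \<le> card C" by (rule tau_attained(2)[OF finE])
  also have "card C \<le> card (\<Union>S \<inter> M) + card (Y \<inter> M) + card (G \<inter> H) + card C'"
    unfolding C_def by (intro order_trans[OF card_Un_le] add_mono order_refl)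
  finally have t: "tau E \<le> card (\<Union>S \<inter> M) + card (Y \<inter> M) + card (G \<inter> H) + card C'" .
  have cS: "card (\<Union>S \<inter> M) = card S"
    using card_Union_Int_disjoint[OF fin(2) disj(2), of M 1] S1 tri(2) triangle_card(2) by auto
  have cY: "card (Y \<inter> M) = 2 * (card Q - card R)"
  proof -
    have "card (\<Union>(Q - own ` R) \<inter> M) = 2 * card (Q - own ` R)"
    proof (rule card_Union_Int_disjoint)
      show "disjoint (Q - own ` R)" using disj(3) by (rule pairwise_subset) auto
      show "finite T \<and> card (T \<inter> M) = 2" if "T \<in> Q - own ` R" for T
        using that Q2 tri(3) triangle_card(2)[of T E] by auto
    qed (use fin in auto)
    then show ?thesis unfolding Y_def card_unpaged .
  qed
  have "card (M - \<Union>S - Y) + card S + 2 * (card Q - card R) \<le> 3 * card P"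
  proof -
    have "(\<Union>S \<inter> M) \<inter> (Y \<inter> M) = {}" using SQ_disj(1) unfolding Y_def by blast
    moreover have fM: "finite M" using ME finE by (rule finite_subset)
    ultimately have "card ((\<Union>S \<inter> M) \<union> (Y \<inter> M)) = card S + 2 * (card Q - card R)"
      unfolding cS[symmetric] cY[symmetric] by (intro card_Un_disjoint) auto
    moreover have "M - \<Union>S - Y = M - ((\<Union>S \<inter> M) \<union> (Y \<inter> M))" by blast
    moreover have "card (M - ((\<Union>S \<inter> M) \<union> (Y \<inter> M))) + card ((\<Union>S \<inter> M) \<union> (Y \<inter> M)) = card M"
      using fM by (subst card_Diff_subset) (auto intro!: le_add_diff_inverse2 card_mono)
    moreover have "card M \<le> 3 * card P" by (rule card_Union_triangles[OF fin(1) tri(1)])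
    ultimately show ?thesis by simp
  qed
  moreover have "card (\<Union>S - M) \<le> 2 * card S"
    using card_Union_Int[OF fin(2), of "- M" 2] card_Diff_triangle(1)[OF _ S1] tri(2)
    by (auto simp: Diff_eq)
  moreover have "card (\<Union>Q - M) \<le> card Q"
    using card_Union_Int[OF fin(3), of "- M" 1] card_Diff_triangle(1)[OF _ Q2] tri(3)
    by (auto simp: Diff_eq)
  moreover have "card H \<le> card (M - \<Union>S - Y) + card (\<Union>S - M) + card (\<Union>Q - M) + card oppK"
    unfolding H_def by (intro order_trans[OF card_Un_le] add_mono order_refl)
  ultimately have cH: "card H + 2 * (card Q - card R) \<le> 3 * card P + card S + card Q + card K"
    using card_oppK by linarith
  \<comment> \<open>An edge of \<open>G\<close> inside \<open>H\<close> moves from half to full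
    price, and one outside \<open>H\<close> enters at half price: in doubled cost either adds
    one.\<close>
  have "card H' \<le> card (H - G) + card (G - H)" unfolding H'_def by (rule card_Un_le)
  moreover have "card (H - G) + card (G \<inter> H) = card H"
    using finH by (metis Diff_Diff_Int Diff_disjoint Int_commute card_Diff_subset_Int card_Int_Diff add.commute)
  moreover have "card (G - H) + card (G \<inter> H) = card G"
    using finG by (metis card_Int_Diff add.commute)
  moreover have "card G \<le> card S"
    using card_mono[of "g ` S" G] card_image_le[OF fin(2), of g] fin by (auto simp: G_def)
  ultimately have "card H' + 2 * card (G \<inter> H) \<le> card H + card S" by linarith
  then have "2 * tau E \<le> 2 * card S + 4 * (card Q - card R) + card H + card S"
    using t C'(2) cS cY by linarith
  then show ?thesis using cH card_R by linarith
qed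

end

section \<open>Existence of the choices and combination of the bounds\<close>

lemma greatest_nat:
  fixes f :: "'b \<Rightarrow> nat"
  assumes "P k" "\<And>y. P y \<Longrightarrow> f y \<le> b"
  obtains x where "P x" "\<And>y. P y \<Longrightarrow> f y \<le> f x"
  using ex_has_greatest_nat[of P k f "Suc b"] assms by (auto simp: less_Suc_eq_le)

context lex_packing
begin

lemma card_types: "card S + card Q + card Z \<le> card P"
proof -
  have "card (S \<union> Q \<union> Z) = card S + card Q + card Z"
    using fin distinct_types by (subst card_Un_disjoint; auto simp: card_Un_disjoint)+
  then show ?thesis using maxP[OF pack] by simp
qed

lemma tau_bound: "14 * tau E \<le> 39 * card P"
proof -
  define pages where "pages X \<longleftrightarrow> X \<subseteq> Collect page \<and> disjoint X" for X
  have "pages {}" by (simp add: pages_def)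
  \<comment> \<open>Disjoint pages form a packing; this bounds their number and yields a largest
    family.\<close>
  moreover have "card X \<le> card P" if X: "pages X" for X
  proof (rule maxP)
    show "triangle_packing E X"
      using X pageD(1) unfolding pages_def triangle_packing_def by blast
  qed
  ultimately obtain R where R: "pages R" and Rmax: "\<And>X. pages X \<Longrightarrow> card X \<le> card R"
    using greatest_nat[of pages "{}" card "card P"] by metis
  have Rt: "R \<subseteq> triangles E" using R pageD(1) unfolding pages_def by blast
  have "\<exists>D n. D \<in> Q \<and> T \<inter> \<Union>Q = {n} \<and> D \<inter> T = {n} \<and> n \<notin> M \<and> T \<inter> - M = {n} \<and> D \<inter> - M = {n}"
    if "T \<in> R" for T
  proof -
    have "page T" using that R by (auto simp: pages_def)
    then show ?thesis by (rule page_spine) blast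
  qed
  then obtain own sp where own: "\<And>T. T \<in> R \<Longrightarrow> own T \<in> Q \<and> T \<inter> \<Union>Q = {sp T} \<and> own T \<inter> T = {sp T}
      \<and> sp T \<notin> M \<and> T \<inter> - M = {sp T} \<and> own T \<inter> - M = {sp T}"
    by metis
  interpret lex_pages V E P S Q Z R own sp
  proof
    show "page T" if "T \<in> R" for T using that R by (auto simp: pages_def)
    show "disjoint R" using R by (simp add: pages_def)
    show "T \<inter> \<Union>R \<noteq> {}" if T: "page T" for T
    proof
      assume "T \<inter> \<Union>R = {}"
      moreover have "triangle_packing E R" using R Rt by (simp add: pages_def triangle_packing_def)
      ultimately have "triangle_packing E (insert T R)" "T \<notin> R"
        using packing_insert pageD(1)[OF T] by blast+
      then have "pages (insert T R)" using R T by (simp add: pages_def triangle_packing_def)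
      then show False using Rmax[of "insert T R"] \<open>T \<notin> R\<close> packing_finite[OF finE Rt] by simp
    qed
  qed (rule own)
  have "tau E + card S \<le> 3 * card P"
    by (rule tau_singles_bound[OF finE packP maxP tri(2) disj(2) S1])
  \<comment> \<open>With weights 4, 5, 3, 1 the terms \<open>card S\<close>, \<open>card Q\<close>
    and \<open>card Z\<close> all get coefficient 24, while \<open>card R\<close> gets -3 and
    \<open>card K\<close> gets 3.\<close>
  then show ?thesis
    using cover_swap_bound cover_double_bound cover_half_bound card_K card_types by linarith
qed

end

text \<open>Three successive maximisations. \<open>S\<close> is kept from the first, but only the
  size of \<open>Q0\<close> from the second: the final \<open>Q\<close> is chosen together with
  \<open>Z\<close>, which gives \<open>maxZ\<close> against all exchanges in
  \<open>Q\<close>.\<close>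

lemma lex_packing_exists:
  assumes graph: "finite_simple_graph V E"
    and P: "triangle_packing E P" "\<And>P'. triangle_packing E P' \<Longrightarrow> card P' \<le> card P"
  obtains S Q Z where "lex_packing V E P S Q Z"
proof -
  define c where "c k X \<longleftrightarrow> (\<forall>T\<in>X. card (T \<inter> \<Union>P) = k)" for k X
  have sub: "triangle_packing E X" if "triangle_packing E Y" "X \<subseteq> Y" for X Y
    using that by (auto simp: triangle_packing_def intro: pairwise_subset)
  have bd: "card X \<le> card P" if "triangle_packing E Y" "X \<subseteq> Y" for X Y
    using P(2) sub[OF that] by blast
  have "triangle_packing E {} \<and> c 1 {}" by (simp add: triangle_packing_def c_def)
  then obtain S where S: "triangle_packing E S \<and> c 1 S"
    and maxS: "\<And>S'. triangle_packing E S' \<and> c 1 S' \<Longrightarrow> card S' \<le> card S"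
    using greatest_nat[of "\<lambda>S. triangle_packing E S \<and> c 1 S" "{}" card "card P"] P(2) by metis
  have "triangle_packing E (S \<union> {}) \<and> c 2 {}" using S by (simp add: c_def)
  then obtain Q0 where Q0: "triangle_packing E (S \<union> Q0) \<and> c 2 Q0"
    and maxQ: "\<And>Q'. triangle_packing E (S \<union> Q') \<and> c 2 Q' \<Longrightarrow> card Q' \<le> card Q0"
    using greatest_nat[of "\<lambda>Q. triangle_packing E (S \<union> Q) \<and> c 2 Q" "{}" card "card P"] bd Un_upper2
    by metis
  define good where "good x \<longleftrightarrow> triangle_packing E (S \<union> fst x \<union> snd x) \<and> c 2 (fst x) \<and> c 3 (snd x) \<and>
    card (fst x) = card Q0" for x
  have "good (Q0, {})" using Q0 by (simp add: good_def c_def)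
  moreover have "card (snd x) \<le> card P" if "good x" for x
    using bd[of "S \<union> fst x \<union> snd x" "snd x"] that by (simp add: good_def)
  ultimately obtain x where "good x" "\<And>y. good y \<Longrightarrow> card (snd y) \<le> card (snd x)"
    using greatest_nat[of good "(Q0, {})" "card \<circ> snd" "card P"] by (metis comp_apply)
  then obtain Q Z where QZ: "good (Q, Z)" and maxZ: "\<And>Q' Z'. good (Q', Z') \<Longrightarrow> card Z' \<le> card Z"
    by (metis prod.collapse snd_conv)
  have "lex_packing V E P S Q Z"
  proof
    show "card S' \<le> card S"
      if "triangle_packing E S'" "\<And>T. T \<in> S' \<Longrightarrow> card (T \<inter> \<Union>P) = 1" for S'
      using maxS that by (simp add: c_def)
    show "card Q' \<le> card Q"
      if "triangle_packing E (S \<union> Q')" "\<And>T. T \<in> Q' \<Longrightarrow> card (T \<inter> \<Union>P) = 2" for Q'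
      using maxQ that QZ by (simp add: c_def good_def)
    show "card Z' \<le> card Z"
      if "triangle_packing E (S \<union> Q' \<union> Z')" "\<And>T. T \<in> Q' \<Longrightarrow> card (T \<inter> \<Union>P) = 2"
        "\<And>T. T \<in> Z' \<Longrightarrow> card (T \<inter> \<Union>P) = 3" "card Q' = card Q" for Q' Z'
      using maxZ[of Q' Z'] that QZ by (simp add: c_def good_def)
  qed (use graph P S QZ in \<open>auto simp: c_def good_def\<close>)
  then show ?thesis by (rule that)
qed

theorem theorem1:
  fixes V :: "'a set" and E :: "'a set set"
  assumes "finite_simple_graph V E"
  shows "real (tau E) \<le> 165 / 59 * real (nu E)"
proof -
  note finE = finite_edges[OF assms]
  obtain P where P: "triangle_packing E P" "card P = nu E" using nu_attained(1)[OF finE] by blast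
  have "card P' \<le> card P" if "triangle_packing E P'" for P'
    using nu_attained(2)[OF finE that] P(2) by simp
  from lex_packing_exists[OF assms P(1) this] obtain S Q Z where "lex_packing V E P S Q Z" .
  then have "14 * tau E \<le> 39 * nu E" using lex_packing.tau_bound P(2) by metis
  then have "14 * real (tau E) \<le> 39 * real (nu E)" by linarith
  \<comment> \<open>The fractions compare by 39 * 59 = 2301 < 2310 = 14 * 165.\<close>
  then show ?thesis by simp
qed

end
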